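(* Let $X$ be a real-valued centered Gaussian process indexed by $[0,1]$ with $X(0)=0$ a.s., let $1\le p\le\infty$, and let $n\ge1$ be an integer. If $X$ is $n$-times differentiable with $X^{(n)}\in L_2[0,1]$ a.s., then $$\limsup_{\varepsilon\to0}\ \varepsilon^{1/n}\left(-\log\mathbb{P}\left[\|X\|_{L_p[0,1]}\le\varepsilon\right]\right)<\infty.$$ If the process $X$ is $\mathcal{C}^\infty$, then $$\lim_{\varepsilon\to0}\varepsilon^{\delta}\left(-\log\mathbb{P}\left[\|X\|_{L_p[0,1]}\le\varepsilon\right]\right)=0\qquad\text{for all }\delta>0.$$
   Context: $X^{(n)}$ denotes the $n$-th (path-wise) derivative of $X$; $X$ being $n$-times differentiable or $\mathcal{C}^\infty$ means that its sample paths on $[0,1]$ have this property almost surely. *)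

theory Defs
  imports "HOL-Probability.Probability"
begin

text \<open>The degenerate case (a point mass) counts as Gaussian.\<close>

definition gaussian_rv :: "'a measure \<Rightarrow> ('a \<Rightarrow> real) \<Rightarrow> bool" where
  "gaussian_rv M Y \<longleftrightarrow> Y \<in> borel_measurable M \<and>
     (\<exists>\<mu> \<sigma>. \<sigma> \<ge> 0 \<and>
       distr M borel Y = (if \<sigma> = 0 then return borel \<mu> else density lborel (normal_density \<mu> \<sigma>)))"

text \<open>Finite-dimensional distributions are Gaussian: every finite linear combination is Gaussian.\<close>

definition gaussian_process :: "'a measure \<Rightarrow> 'i set \<Rightarrow> ('i \<Rightarrow> 'a \<Rightarrow> real) \<Rightarrow> bool" where
  "gaussian_process M I X \<longleftrightarrow>
     (\<forall>T c. finite T \<and> T \<subseteq> I \<longrightarrow> gaussian_rv M (\<lambda>\<omega>. \<Sum>t\<in>T. c t * X t \<omega>))"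

definition centered_gaussian_process ::
    "'a measure \<Rightarrow> 'i set \<Rightarrow> ('i \<Rightarrow> 'a \<Rightarrow> real) \<Rightarrow> bool" where
  "centered_gaussian_process M I X \<longleftrightarrow>
     gaussian_process M I X \<and> (\<forall>t\<in>I. integral\<^sup>L M (X t) = 0)"

text \<open>Iterated derivatives of a function on $[0,1]$, one-sided at the end points; they do not
  depend on the values of the function outside $[0,1]$ and are meaningful on $[0,1]$ only.\<close>

primrec nth_deriv01 :: "nat \<Rightarrow> (real \<Rightarrow> real) \<Rightarrow> real \<Rightarrow> real" where
  "nth_deriv01 0 f = f"
| "nth_deriv01 (Suc n) f = (\<lambda>t. vector_derivative (nth_deriv01 n f) (at t within {0..1}))"

definition times_differentiable01 :: "nat \<Rightarrow> (real \<Rightarrow> real) \<Rightarrow> bool" where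
  "times_differentiable01 n f \<longleftrightarrow> (\<forall>k<n. nth_deriv01 k f differentiable_on {0..1})"

definition smooth01 :: "(real \<Rightarrow> real) \<Rightarrow> bool" where
  "smooth01 f \<longleftrightarrow> (\<forall>n. times_differentiable01 n f)"

text \<open>The norm of $L_p[0,1]$ for $1 \le p \le \infty$, with value \<open>\<infinity>\<close> for functions outside
  that space, in particular for all non-measurable ones.\<close>

definition Lp_norm01 :: "ennreal \<Rightarrow> (real \<Rightarrow> real) \<Rightarrow> ennreal" where
  "Lp_norm01 p f =
     (if f \<notin> borel_measurable (lebesgue_on {0..1}) then \<infinity>
      else if p = \<infinity> then esssup (lebesgue_on {0..1}) (\<lambda>t. ennreal \<bar>f t\<bar>)
      else let J = (\<integral>\<^sup>+ t. ennreal (\<bar>f t\<bar> powr enn2real p) \<partial>lebesgue_on {0..1})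
           in if J = \<infinity> then \<infinity> else ennreal (enn2real J powr (1 / enn2real p)))"

definition in_Lp01 :: "ennreal \<Rightarrow> (real \<Rightarrow> real) \<Rightarrow> bool" where
  "in_Lp01 p f \<longleftrightarrow> Lp_norm01 p f < \<infinity>"

text \<open>Path properties hold only almost surely, so on an incomplete space the event
  $\{\|X\|_{L_p} \le \varepsilon\}$ may be measurable only up to a null set; hence the completion,
  which changes nothing when \<open>M\<close> is complete.\<close>

definition small_ball_prob :: "'a measure \<Rightarrow> (real \<Rightarrow> 'a \<Rightarrow> real) \<Rightarrow> ennreal \<Rightarrow> real \<Rightarrow> real" where
  "small_ball_prob M X p \<epsilon> =
     measure (completion M) {\<omega> \<in> space M. Lp_norm01 p (\<lambda>t. X t \<omega>) \<le> ennreal \<epsilon>}"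

text \<open>The convention $-\log 0 = \infty$; recall that \<open>ln 0 = 0\<close> on the reals.\<close>

definition neg_log :: "real \<Rightarrow> ereal" where
  "neg_log x = (if x \<le> 0 then \<infinity> else ereal (- ln x))"

end

theory Submission
  imports Defs
begin

text \<open>
  Some Sobolev ball is hit by the path of $X$ with positive outer probability. In the supremum norm
  it is covered, for every $k$, by $N \le K^k$ balls of radius $\eta = C k^{-n}$, so one of them
  contains the path with probability at least $c / N$. For an independent copy $X'$ the difference
  $X - X'$ has the law of $\sqrt 2 X$, whence $P(\|X\|_\infty \le \sqrt 2 \eta) \ge (c / N)^2$. This
  is the bound $\varepsilon^{-1/n}$ for the supremum norm, which dominates all $L_p$ norms on $[0,1]$.

  The entropy bound is reduced to $n = 1$ by differentiation. For $n = 1$ the function is replaced by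
  a step function on an adaptive dyadic partition; a uniform partition would not do, because
  $f' \in L_2$ may concentrate.
\<close>

text \<open>The exponent $1/n$ leaves no room for a logarithm: at radius of order $k^{-n}$ the
  logarithm of the covering number must be $O(k)$. Hence only the start value is recorded
  absolutely, which costs a factor polynomial in $k$, and every leaf adds one of seven increments.
  The order of choices matters as well. The radius $r$ of the Sobolev ball, and with it $c$, $K$ and
  $C$, must be fixed before $k$, since a probability that decayed with $k$ would spoil the bound.
  Almost sure regularity puts the path into a countable union of balls of integer radius, so one
  radius serves all $k$ at once. Squaring the probability only doubles its logarithm. The law of $X$
  is accessible through finitely many times only; events are therefore formed over rational times,
  and continuity of the paths extends them to $[0,1]$.\<close>

subsection \<open>Metric entropy of Sobolev balls\<close>

text \<open>A code is a dyadic partition of an interval, refined only where the function needs it,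
  together with the increments of an integer-valued step function from each leaf to the next;
  the step function is read off from its start value \<open>q\<close>.\<close>

datatype code = Leaf int | Node code code

primrec exit_value :: "code \<Rightarrow> int \<Rightarrow> int" where
  "exit_value (Leaf d) q = q + d"
| "exit_value (Node l r) q = exit_value r (exit_value l q)"

primrec decode :: "code \<Rightarrow> int \<Rightarrow> real \<Rightarrow> real \<Rightarrow> real \<Rightarrow> int" where
  "decode (Leaf d) q a b x = q + d"
| "decode (Node l r) q a b x =
     (if x \<le> (a + b) / 2 then decode l q a ((a + b) / 2) x
      else decode r (exit_value l q) ((a + b) / 2) b x)"

primrec leaves :: "code \<Rightarrow> nat" where
  "leaves (Leaf d) = 1"
| "leaves (Node l r) = leaves l + leaves r"

primrec small_labels :: "code \<Rightarrow> bool" where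
  "small_labels (Leaf d) \<longleftrightarrow> d \<in> {-3..3}"
| "small_labels (Node l r) \<longleftrightarrow> small_labels l \<and> small_labels r"

primrec serialize :: "code \<Rightarrow> int option list" where
  "serialize (Leaf d) = [Some d]"
| "serialize (Node l r) = None # serialize l @ serialize r"

text \<open>Preorder (Polish) notation is a prefix code. The arbitrary tails make the induction
  work, and they also show that padding to a common length loses no information.\<close>

lemma serialize_append_inject:
  "serialize t @ xs = serialize t' @ ys \<Longrightarrow> t = t' \<and> xs = ys"
proof (induction t arbitrary: t' xs ys)
  case (Leaf d)
  then show ?case by (cases t') auto
next
  case (Node l r)
  from Node.prems obtain l' r' where t': "t' = Node l' r'" by (cases t') auto
  have "serialize l @ serialize r @ xs = serialize l' @ serialize r' @ ys"
    using Node.prems t' by simp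
  from Node.IH(1)[OF this] have "l = l'" "serialize r @ xs = serialize r' @ ys" by auto
  with Node.IH(2)[OF this(2)] t' show ?case by simp
qed

lemma length_serialize: "length (serialize t) + 1 = 2 * leaves t"
  by (induction t) auto

lemma set_serialize: "small_labels t \<Longrightarrow> set (serialize t) \<subseteq> insert None (Some ` {-3..3})"
  by (induction t) auto

lemma codes_finite_card:
  "finite {t. small_labels t \<and> leaves t \<le> L}" "card {t. small_labels t \<and> leaves t \<le> L} \<le> 64 ^ L"
proof -
  let ?S = "{t. small_labels t \<and> leaves t \<le> L}"
  let ?A = "insert None (Some ` {-3..3::int})"
  let ?T = "{xs. set xs \<subseteq> ?A \<and> length xs = 2 * L}"
  let ?f = "\<lambda>t. serialize t @ replicate (2 * L - length (serialize t)) None"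
  have inj: "inj_on ?f ?S"
    by (rule inj_onI) (use serialize_append_inject in blast)
  have sub: "?f ` ?S \<subseteq> ?T"
  proof (rule image_subsetI)
    fix t assume "t \<in> ?S"
    then show "?f t \<in> ?T"
      using length_serialize[of t] set_serialize[of t] by auto
  qed
  have A: "card ?A = 8"
    by (subst card_insert_disjoint) (auto simp: card_image)
  have fin: "finite ?T" by (rule finite_lists_length_eq) simp
  show "finite ?S" using inj_on_finite[OF inj sub fin] .
  have "card ?S \<le> card ?T" using card_inj_on_le[OF inj sub fin] .
  \<comment> \<open>The alphabet has eight symbols, \<open>None\<close> and seven labels; a binary
    tree with \<open>L\<close> leaves has $2L - 1$ nodes, so words of length $2L$ suffice.\<close>
  also have "\<dots> = 8 ^ (2 * L)" by (subst card_lists_length_eq) (simp_all only: A, simp)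
  also have "\<dots> = 64 ^ L" by (simp add: power_mult)
  finally show "card ?S \<le> 64 ^ L" .
qed

section \<open>Adaptive approximation by step functions\<close>

lemma round_div_error:
  fixes x \<eta> :: real
  assumes "\<eta> > 0"
  shows "\<bar>x - \<eta> * of_int (round (x / \<eta>))\<bar> \<le> \<eta>"
proof -
  have "\<bar>of_int (round (x / \<eta>)) - x / \<eta>\<bar> \<le> 1/2"
    by (rule of_int_round_abs_le)
  then have "\<eta> * \<bar>of_int (round (x / \<eta>)) - x / \<eta>\<bar> \<le> \<eta> * 1"
    using assms by (intro mult_left_mono) auto
  then have "\<bar>\<eta> * (of_int (round (x / \<eta>)) - x / \<eta>)\<bar> \<le> \<eta>"
    using assms by (simp add: abs_mult)
  moreover have "\<eta> * (of_int (round (x / \<eta>)) - x / \<eta>) = \<eta> * of_int (round (x / \<eta>)) - x"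
    using assms by (simp add: field_simps)
  ultimately show ?thesis by (simp add: abs_minus_commute)
qed

text \<open>For $f' \in L_2$ one takes $E(t) = \int_0^t |f'|^2$; for Lipschitz $f$ a linear \<open>E\<close>.\<close>

definition controlled_by :: "(real \<Rightarrow> real) \<Rightarrow> (real \<Rightarrow> real) \<Rightarrow> real \<Rightarrow> real \<Rightarrow> bool" where
  "controlled_by E f a b \<longleftrightarrow>
     (\<forall>s t. a \<le> s \<and> s \<le> t \<and> t \<le> b \<longrightarrow> (f t - f s)\<^sup>2 \<le> (t - s) * (E t - E s))"

lemma controlled_byD:
  "controlled_by E f a b \<Longrightarrow> a \<le> s \<Longrightarrow> s \<le> t \<Longrightarrow> t \<le> b \<Longrightarrow> (f t - f s)\<^sup>2 \<le> (t - s) * (E t - E s)"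
  by (simp add: controlled_by_def)

lemma controlled_by_subinterval:
  "controlled_by E f a b \<Longrightarrow> a \<le> c \<Longrightarrow> d \<le> b \<Longrightarrow> controlled_by E f c d"
  by (auto simp: controlled_by_def)

lemma controlled_by_mono:
  assumes "controlled_by E f a b" "a \<le> s" "s \<le> t" "t \<le> b"
  shows "E s \<le> E t"
proof (cases "s = t")
  case False
  then have "0 \<le> (t - s) * (E t - E s)"
    using controlled_byD[OF assms] by (meson order_trans zero_le_power2)
  then show ?thesis using False assms by (simp add: zero_le_mult_iff)
qed simp

definition step_approx :: "real \<Rightarrow> (real \<Rightarrow> real) \<Rightarrow> real \<Rightarrow> real \<Rightarrow> int \<Rightarrow> code \<Rightarrow> bool" where
  "step_approx \<eta> f a b q t \<longleftrightarrow>
     (\<forall>x. a \<le> x \<and> x \<le> b \<longrightarrow> \<bar>f x - \<eta> * of_int (decode t q a b x)\<bar> \<le> 2 * \<eta>) \<and>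
     \<bar>f b - \<eta> * of_int (exit_value t q)\<bar> \<le> 2 * \<eta>"

lemma leaf_approx:
  assumes c: "controlled_by E f a b" and ab: "a \<le> b" and \<eta>: "\<eta> > 0"
    and q: "\<bar>f a - \<eta> * of_int q\<bar> \<le> 2 * \<eta>"
    and small: "(b - a) * (E b - E a) \<le> \<eta>\<^sup>2"
  shows "\<exists>d\<in>{-3..3}. step_approx \<eta> f a b q (Leaf d)"
proof -
  define d where "d = round (f a / \<eta>) - q"
  have r: "\<bar>f a - \<eta> * of_int (q + d)\<bar> \<le> \<eta>"
    using round_div_error[OF \<eta>, of "f a"] by (simp add: d_def)
  have osc: "\<bar>f x - f a\<bar> \<le> \<eta>" if "a \<le> x" "x \<le> b" for x
  proof -
    have "(f x - f a)\<^sup>2 \<le> (x - a) * (E x - E a)"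
      using controlled_byD[OF c] that by auto
    also have "\<dots> \<le> (b - a) * (E b - E a)"
      using that controlled_by_mono[OF c, of a x] controlled_by_mono[OF c, of x b]
      by (intro mult_mono) auto
    also have "\<dots> \<le> \<eta>\<^sup>2" by (rule small)
    finally show ?thesis using \<eta> by (metis abs_le_square_iff abs_of_pos)
  qed
  have "\<bar>\<eta> * of_int d\<bar> \<le> 3 * \<eta>"
    using r q by (simp add: algebra_simps)
  then have "\<eta> * \<bar>of_int d\<bar> \<le> \<eta> * 3"
    using \<eta> by (simp add: abs_mult)
  then have "\<bar>of_int d :: real\<bar> \<le> 3"
    using \<eta> mult_le_cancel_left_pos by blast
  then have "d \<in> {-3..3}" by auto
  moreover have "\<bar>f x - \<eta> * of_int (q + d)\<bar> \<le> 2 * \<eta>" if "a \<le> x" "x \<le> b" for x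
    using osc[OF that] r by linarith
  ultimately show ?thesis using ab by (intro bexI[of _ d]) (auto simp: step_approx_def)
qed

text \<open>With $x = \sqrt{(b - a)(E(b) - E(a))} / \eta$, the two halves satisfy
  $x_1^2 + x_2^2 = x^2 / 2$, hence $x_1 + x_2 \le x$: this is why the linear bound on the number
  of leaves survives the recursion.\<close>

lemma code_exists:
  assumes "controlled_by E f a b" "a \<le> b" "\<eta> > 0"
    and "\<bar>f a - \<eta> * of_int q\<bar> \<le> 2 * \<eta>"
    and "(b - a) * (E b - E a) \<le> 2 ^ D * \<eta>\<^sup>2"
  shows "\<exists>t. small_labels t \<and> step_approx \<eta> f a b q t \<and>
             real (leaves t) \<le> max 1 (4 * (sqrt ((b - a) * (E b - E a)) / \<eta>))"
  using assms
proof (induction D arbitrary: a b q)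
  case 0
  then obtain d where "d \<in> {-3..3}" "step_approx \<eta> f a b q (Leaf d)"
    using leaf_approx[of E f a b \<eta> q] by auto
  then show ?case by (intro exI[of _ "Leaf d"]) auto
next
  case (Suc D)
  show ?case
  proof (cases "(b - a) * (E b - E a) \<le> \<eta>\<^sup>2")
    case True
    then obtain d where "d \<in> {-3..3}" "step_approx \<eta> f a b q (Leaf d)"
      using leaf_approx[of E f a b \<eta> q] Suc.prems by auto
    then show ?thesis by (intro exI[of _ "Leaf d"]) auto
  next
    case False
    define m where "m = (a + b) / 2"
    have m: "a \<le> m" "m \<le> b" "m - a = (b - a) / 2" "b - m = (b - a) / 2"
      using Suc.prems(2) by (auto simp: m_def field_simps)
    note mono = controlled_by_mono[OF Suc.prems(1)]
    have c1: "controlled_by E f a m" and c2: "controlled_by E f m b"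
      using controlled_by_subinterval[OF Suc.prems(1)] m by auto
    have half: "(m - a) * (E m - E a) \<le> (b - a) * (E b - E a) / 2"
      "(b - m) * (E b - E m) \<le> (b - a) * (E b - E a) / 2"
    proof -
      have "(b - a) * (E m - E a) \<le> (b - a) * (E b - E a)"
        "(b - a) * (E b - E m) \<le> (b - a) * (E b - E a)"
        using m mono[of a m] mono[of m b] Suc.prems(2) by (auto intro!: mult_left_mono)
      then show "(m - a) * (E m - E a) \<le> (b - a) * (E b - E a) / 2"
        "(b - m) * (E b - E m) \<le> (b - a) * (E b - E a) / 2"
        unfolding m(3,4) by simp_all
    qed
    have h1: "(m - a) * (E m - E a) \<le> 2 ^ D * \<eta>\<^sup>2" "(b - m) * (E b - E m) \<le> 2 ^ D * \<eta>\<^sup>2"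
      using half Suc.prems(5) by auto
    obtain l where l: "small_labels l" "step_approx \<eta> f a m q l"
      "real (leaves l) \<le> max 1 (4 * (sqrt ((m - a) * (E m - E a)) / \<eta>))"
      using Suc.IH[OF c1 m(1) Suc.prems(3,4) h1(1)] by auto
    have q': "\<bar>f m - \<eta> * of_int (exit_value l q)\<bar> \<le> 2 * \<eta>"
      using l(2) by (simp add: step_approx_def)
    obtain r where r: "small_labels r" "step_approx \<eta> f m b (exit_value l q) r"
      "real (leaves r) \<le> max 1 (4 * (sqrt ((b - m) * (E b - E m)) / \<eta>))"
      using Suc.IH[OF c2 m(2) Suc.prems(3) q' h1(2)] by auto
    define x where "x = sqrt ((b - a) * (E b - E a)) / \<eta>"
    define x1 where "x1 = sqrt ((m - a) * (E m - E a)) / \<eta>"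
    define x2 where "x2 = sqrt ((b - m) * (E b - E m)) / \<eta>"
    have nn: "0 \<le> (b - a) * (E b - E a)" "0 \<le> (m - a) * (E m - E a)" "0 \<le> (b - m) * (E b - E m)"
      using m mono[of a m] mono[of m b] mono[of a b] Suc.prems(2) by auto
    have sq: "x\<^sup>2 = ((b - a) * (E b - E a)) / \<eta>\<^sup>2" "x1\<^sup>2 = ((m - a) * (E m - E a)) / \<eta>\<^sup>2"
      "x2\<^sup>2 = ((b - m) * (E b - E m)) / \<eta>\<^sup>2"
      using nn by (simp_all add: x_def x1_def x2_def power_divide)
    have pos: "x \<ge> 0" "x1 \<ge> 0" "x2 \<ge> 0"
      using nn Suc.prems(3) by (auto simp: x_def x1_def x2_def)
    have "1 < x\<^sup>2" using False Suc.prems(3) by (simp add: sq field_simps)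
    then have x1': "1 < x" using pos by (metis abs_of_nonneg one_less_power power2_eq_square
          abs_square_le_1 linorder_not_less)
    have "(m - a) * (E m - E a) + (b - m) * (E b - E m) = (b - a) * (E b - E a) / 2"
      unfolding m(3,4) by (simp add: field_simps)
    then have sum2: "x1\<^sup>2 + x2\<^sup>2 = x\<^sup>2 / 2"
      unfolding sq by (metis add_divide_distrib divide_divide_eq_left mult.commute)
    have "(x1 + x2)\<^sup>2 \<le> x\<^sup>2"
    proof -
      have "(x1 + x2)\<^sup>2 \<le> 2 * (x1\<^sup>2 + x2\<^sup>2)"
        using zero_le_power2[of "x1 - x2"] by (simp add: power2_eq_square algebra_simps)
      then show ?thesis using sum2 by simp
    qed
    then have add: "x1 + x2 \<le> x" using pos(1) by (rule power2_le_imp_le)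
    have three: "y \<le> 3 / 4 * x" if "y\<^sup>2 \<le> x\<^sup>2 / 2" for y
    proof (rule power2_le_imp_le)
      have "x\<^sup>2 / 2 \<le> (3 / 4 * x)\<^sup>2"
        by (simp add: power2_eq_square)
      then show "y\<^sup>2 \<le> (3 / 4 * x)\<^sup>2" using that by linarith
    qed (use pos in simp)
    have t1: "x1 \<le> 3 / 4 * x" and t2: "x2 \<le> 3 / 4 * x"
      using sum2 zero_le_power2[of x1] zero_le_power2[of x2] by (intro three; linarith)+
    have count: "real (leaves (Node l r)) \<le> 4 * x"
      using l(3) r(3) add t1 t2 x1' unfolding x1_def[symmetric] x2_def[symmetric] leaves.simps
      by linarith
    have "step_approx \<eta> f a b q (Node l r)"
      using l(2) r(2) unfolding step_approx_def
      by (auto simp: m_def[symmetric] not_le)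
    then show ?thesis
      using l(1) r(1) count x1' unfolding x_def by (intro exI[of _ "Node l r"]) auto
  qed
qed

definition bounded_energy :: "real \<Rightarrow> real \<Rightarrow> (real \<Rightarrow> real) set" where
  "bounded_energy B V = {f. \<bar>f 0\<bar> \<le> B \<and> (\<exists>E. controlled_by E f 0 1 \<and> E 1 - E 0 \<le> V\<^sup>2)}"

lemma bounded_energy_cover:
  fixes B V \<eta> :: real
  assumes "0 \<le> B" "0 \<le> V" "0 < \<eta>"
  shows "\<exists>G. finite G \<and> real (card G) \<le> (2 * (B / \<eta>) + 7) * 64 ^ (nat \<lceil>4 * V / \<eta>\<rceil> + 1) \<and>
     (\<forall>f\<in>bounded_energy B V. \<exists>g\<in>G. \<forall>x\<in>{0..1}. \<bar>f x - g x\<bar> \<le> 2 * \<eta>)"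
proof -
  define L where "L = nat \<lceil>4 * V / \<eta>\<rceil> + 1"
  define T where "T = {t. small_labels t \<and> leaves t \<le> L}"
  define Q where "Q = \<lceil>B / \<eta>\<rceil> + 1"
  define g where "g = (\<lambda>(q, t) x. \<eta> * of_int (decode t q 0 1 x))"
  define G where "G = g ` ({-Q..Q} \<times> T)"
  have B0: "0 \<le> B / \<eta>" using assms by simp
  have Q0: "0 \<le> Q" using B0 by (simp add: Q_def)
  have T: "finite T" "card T \<le> 64 ^ L" using codes_finite_card by (auto simp: T_def)
  have "finite G" using T by (simp add: G_def)
  moreover have "real (card G) \<le> (2 * (B / \<eta>) + 7) * 64 ^ L"
  proof -
    have "card G \<le> card ({-Q..Q} \<times> T)" unfolding G_def by (rule card_image_le) (use T in simp)
    then have "real (card G) \<le> real (nat (2 * Q + 1)) * real (card T)"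
      by (simp add: card_cartesian_product flip: of_nat_mult)
    also have "\<dots> \<le> (2 * (B / \<eta>) + 7) * 64 ^ L"
    proof (rule mult_mono)
      have "real (nat (2 * Q + 1)) = 2 * real_of_int \<lceil>B / \<eta>\<rceil> + 3"
        using Q0 by (simp add: Q_def)
      also have "\<dots> \<le> 2 * (B / \<eta>) + 7" by linarith
      finally show "real (nat (2 * Q + 1)) \<le> 2 * (B / \<eta>) + 7" .
      show "real (card T) \<le> 64 ^ L" using T(2) by (metis of_nat_le_iff of_nat_numeral of_nat_power)
    qed (use B0 in auto)
    finally show ?thesis .
  qed
  moreover have "\<exists>g\<in>G. \<forall>x\<in>{0..1}. \<bar>f x - g x\<bar> \<le> 2 * \<eta>" if f: "f \<in> bounded_energy B V" for f
  proof -
    obtain E where E: "controlled_by E f 0 1" "E 1 - E 0 \<le> V\<^sup>2" and f0: "\<bar>f 0\<bar> \<le> B"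
      using f by (auto simp: bounded_energy_def)
    define q where "q = round (f 0 / \<eta>)"
    have "\<bar>f 0 - \<eta> * of_int q\<bar> \<le> \<eta>" unfolding q_def by (rule round_div_error) (use assms in simp)
    then have q: "\<bar>f 0 - \<eta> * of_int q\<bar> \<le> 2 * \<eta>" using assms by simp
    have "\<bar>f 0 / \<eta>\<bar> \<le> B / \<eta>" using f0 assms by (simp add: divide_right_mono)
    then have "\<bar>real_of_int q\<bar> \<le> B / \<eta> + 1"
      using of_int_round_abs_le[of "f 0 / \<eta>"] unfolding q_def by linarith
    then have qQ: "q \<in> {-Q..Q}"
      unfolding Q_def atLeastAtMost_iff by linarith
    \<comment> \<open>The depth \<open>D\<close> only makes the recursion stop; it depends on
      \<open>f\<close> but does not enter the number of leaves.\<close>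
    obtain D :: nat where "(E 1 - E 0) / \<eta>\<^sup>2 < 2 ^ D" using real_arch_pow[of 2] by auto
    then have "(1 - 0) * (E 1 - E 0) \<le> 2 ^ D * \<eta>\<^sup>2" using assms by (simp add: field_simps)
    from code_exists[OF E(1) _ assms(3) q this] obtain t where t: "small_labels t"
      "step_approx \<eta> f 0 1 q t" "real (leaves t) \<le> max 1 (4 * (sqrt ((1 - 0) * (E 1 - E 0)) / \<eta>))"
      by auto
    have "sqrt (E 1 - E 0) \<le> V" using E(2) assms by (simp add: real_le_lsqrt)
    then have "4 * (sqrt (E 1 - E 0) / \<eta>) \<le> 4 * V / \<eta>" using assms by (simp add: divide_right_mono)
    then have "real (leaves t) \<le> max 1 (4 * V / \<eta>)" using t(3) by auto
    moreover have "max 1 (4 * V / \<eta>) \<le> real L"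
    proof -
      have "4 * V / \<eta> \<le> real (nat \<lceil>4 * V / \<eta>\<rceil>)" by linarith
      then show ?thesis by (simp add: L_def)
    qed
    ultimately have "leaves t \<le> L" by linarith
    then have "g (q, t) \<in> G" unfolding G_def using qQ t(1) by (intro imageI) (auto simp: T_def)
    moreover have "\<forall>x\<in>{0..1}. \<bar>f x - g (q, t) x\<bar> \<le> 2 * \<eta>"
      using t(2) by (auto simp: step_approx_def g_def)
    ultimately show ?thesis by blast
  qed
  ultimately show ?thesis unfolding L_def by blast
qed

text \<open>Index shift: \<open>sobolev_ball n R\<close> concerns functions with \<open>Suc n\<close> derivatives, the last one
  in $L_2$.\<close>

primrec sobolev_ball :: "nat \<Rightarrow> real \<Rightarrow> (real \<Rightarrow> real) set" where
  "sobolev_ball 0 R = bounded_energy R R"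
| "sobolev_ball (Suc n) R = {f. \<bar>f 0\<bar> \<le> R \<and>
     (\<exists>f'\<in>sobolev_ball n R. \<forall>t\<in>{0..1}. (f has_real_derivative f' t) (at t within {0..1}))}"

lemma lipschitz_bounded_energy:
  assumes d: "\<And>t. t \<in> {0..1} \<Longrightarrow> (f has_real_derivative f' t) (at t within {0..1})"
    and b: "\<And>t. t \<in> {0..1} \<Longrightarrow> \<bar>f' t\<bar> \<le> V" and "\<bar>f 0\<bar> \<le> B"
  shows "f \<in> bounded_energy B V"
proof -
  have "(f t - f s)\<^sup>2 \<le> (t - s) * (V\<^sup>2 * t - V\<^sup>2 * s)" if "0 \<le> s" "s \<le> t" "t \<le> 1" for s t
  proof -
    have "norm (f t - f s) \<le> V * norm (t - s)"
      by (rule field_differentiable_bound[of "{0..1}" f f']) (use that d b in auto)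
    then have "\<bar>f t - f s\<bar>\<^sup>2 \<le> (V * \<bar>t - s\<bar>)\<^sup>2"
      by (intro power_mono) auto
    then show ?thesis by (simp add: power2_eq_square algebra_simps)
  qed
  then have "controlled_by (\<lambda>t. V\<^sup>2 * t) f 0 1" by (simp add: controlled_by_def)
  then show ?thesis using assms(3) by (auto simp: bounded_energy_def)
qed

lemma power_le_exp: "real k ^ m \<le> (2 ^ m) ^ k"
proof -
  have "real k \<le> 2 ^ k" using less_exp[of k] by (metis less_imp_le of_nat_le_iff of_nat_numeral of_nat_power)
  then have "real k ^ m \<le> (2 ^ k) ^ m" by (intro power_mono) auto
  then show ?thesis by (simp add: mult.commute flip: power_mult)
qed

lemma poly_exp_bound:
  fixes A b :: real
  assumes "1 \<le> A" "1 \<le> k" "1 \<le> b"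
  shows "A * real k ^ m * b ^ (c * k + 1) \<le> (A * 2 ^ m * b ^ (c + 1)) ^ k"
proof -
  have "A * real k ^ m * b ^ (c * k + 1) \<le> A ^ k * (2 ^ m) ^ k * b ^ ((c + 1) * k)"
    using assms by (intro mult_mono power_le_exp power_increasing self_le_power) auto
  also have "\<dots> = (A * 2 ^ m * b ^ (c + 1)) ^ k"
    by (simp only: power_mult power_mult_distrib)
  finally show ?thesis .
qed

text \<open>If $f'$ and $g'$ lie in the same cell of diameter $O(k^{-n})$, then $f - g$ is Lipschitz with that
  constant, and covering such differences gains a further factor $1/k$ at a cost exponential in \<open>k\<close>.\<close>

lemma sobolev_ball_entropy:
  fixes r :: nat
  shows "\<exists>K C. 1 \<le> K \<and> 0 < C \<and> (\<forall>k\<ge>1. \<exists>G. finite G \<and> real (card G) \<le> K ^ k \<and>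
     (\<forall>f\<in>sobolev_ball n (real r). \<exists>g\<in>G. \<forall>x\<in>{0..1}. \<bar>f x - g x\<bar> \<le> C / real k ^ Suc n))"
proof (induction n)
  case 0
  define R where "R = real r"
  have R: "0 \<le> R" by (simp add: R_def)
  let ?K = "(2 * R + 7) * 2 ^ 1 * 64 ^ (4 * r + 1) :: real"
  show ?case
  proof (rule exI[of _ ?K], rule exI[of _ "2::real"], intro conjI allI impI)
    have "1 * 1 * 1 \<le> ?K" using R by (intro mult_mono one_le_power) auto
    then show "1 \<le> ?K" by simp
    fix k :: nat assume k: "1 \<le> k"
    then have k0: "0 < 1 / real k" by simp
    obtain G where G: "finite G"
      "real (card G) \<le> (2 * (R / (1 / real k)) + 7) * 64 ^ (nat \<lceil>4 * R / (1 / real k)\<rceil> + 1)"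
      "\<forall>f\<in>bounded_energy R R. \<exists>g\<in>G. \<forall>x\<in>{0..1}. \<bar>f x - g x\<bar> \<le> 2 * (1 / real k)"
      using bounded_energy_cover[OF R R k0] by blast
    \<comment> \<open>The radius of the ball is a natural number precisely so that this ceiling is
      exact.\<close>
    have "nat \<lceil>4 * R / (1 / real k)\<rceil> = 4 * r * k"
      by (metis R_def divide_divide_eq_right div_by_1 ceiling_of_nat nat_int of_nat_mult of_nat_numeral)
    moreover have "2 * (R / (1 / real k)) + 7 \<le> (2 * R + 7) * real k ^ 1"
      using k by (simp add: algebra_simps)
    ultimately have "real (card G) \<le> (2 * R + 7) * real k ^ 1 * 64 ^ (4 * r * k + 1)"
      using G(2) by (smt (verit) mult_right_mono zero_le_power)
    also have "\<dots> \<le> ?K ^ k"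
      by (rule poly_exp_bound) (use R k in auto)
    finally show "\<exists>G. finite G \<and> real (card G) \<le> ?K ^ k \<and>
        (\<forall>f\<in>sobolev_ball 0 (real r). \<exists>g\<in>G. \<forall>x\<in>{0..1}. \<bar>f x - g x\<bar> \<le> 2 / real k ^ Suc 0)"
      using G by (intro exI[of _ G]) (simp add: R_def)
  qed simp
next
  case (Suc n)
  then obtain K C where K: "1 \<le> K" and C: "0 < C" and IH: "\<And>k. k \<ge> 1 \<Longrightarrow> \<exists>G. finite G \<and> real (card G) \<le> K ^ k \<and>
     (\<forall>f\<in>sobolev_ball n (real r). \<exists>g\<in>G. \<forall>x\<in>{0..1}. \<bar>f x - g x\<bar> \<le> C / real k ^ Suc n)"
    by blast
  define R where "R = real r"
  have R: "0 \<le> R" by (simp add: R_def)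
  let ?A = "2 * R / C + 7"
  let ?K = "K * (?A * 2 ^ (n + 2) * 64 ^ (4 + 1))"
  have A: "1 \<le> ?A" using R C by simp
  show ?case
  proof (rule exI[of _ ?K], rule exI[of _ "4 * C"], intro conjI allI impI)
    have "1 * (1 * 1 * 1) \<le> ?K" using R C K A by (intro mult_mono one_le_power) auto
    then show "1 \<le> ?K" by simp
    show "0 < 4 * C" using C by simp
    fix k :: nat assume k: "1 \<le> k"
    obtain G where G: "finite G" "real (card G) \<le> K ^ k"
      "\<And>f. f \<in> sobolev_ball n R \<Longrightarrow> \<exists>g\<in>G. \<forall>x\<in>{0..1}. \<bar>f x - g x\<bar> \<le> C / real k ^ Suc n"
      using IH[OF k] unfolding R_def by blast
    define V where "V = 2 * C / real k ^ Suc n"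
    define \<eta> where "\<eta> = V / real k"
    have V: "0 < V" using C k by (simp add: V_def)
    have \<eta>: "0 < \<eta>" using V k by (simp add: \<eta>_def)
    obtain H where H: "finite H"
      "real (card H) \<le> (2 * (2 * R / \<eta>) + 7) * 64 ^ (nat \<lceil>4 * V / \<eta>\<rceil> + 1)"
      "\<And>f. f \<in> bounded_energy (2 * R) V \<Longrightarrow> \<exists>g\<in>H. \<forall>x\<in>{0..1}. \<bar>f x - g x\<bar> \<le> 2 * \<eta>"
      using bounded_energy_cover[of "2 * R" V \<eta>] R V \<eta> by auto
    have "4 * V / \<eta> = real (4 * k)" using V k by (simp add: \<eta>_def)
    then have e1: "nat \<lceil>4 * V / \<eta>\<rceil> = 4 * k" by (metis ceiling_of_nat nat_int)
    have "2 * (2 * R / \<eta>) = 2 * R / C * real k ^ (n + 2)"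
      using C k by (simp add: \<eta>_def V_def field_simps)
    moreover have "(7::real) \<le> 7 * real k ^ (n + 2)"
      using one_le_power[of "real k" "n + 2"] k by linarith
    ultimately have e2: "2 * (2 * R / \<eta>) + 7 \<le> ?A * real k ^ (n + 2)"
      by (simp only: distrib_right)
    have "real (card H) \<le> ?A * real k ^ (n + 2) * 64 ^ (4 * k + 1)"
      using H(2) e2 unfolding e1 by (smt (verit) mult_right_mono zero_le_power)
    also have "\<dots> \<le> (?A * 2 ^ (n + 2) * 64 ^ (4 + 1)) ^ k"
      by (rule poly_exp_bound) (use A k in auto)
    finally have cH: "real (card H) \<le> (?A * 2 ^ (n + 2) * 64 ^ (4 + 1)) ^ k" .
    define near where "near = (\<lambda>g f. f \<in> sobolev_ball (Suc n) R \<and> (\<exists>f'. 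
        (\<forall>t\<in>{0..1}. (f has_real_derivative f' t) (at t within {0..1})) \<and>
        (\<forall>x\<in>{0..1}. \<bar>f' x - g x\<bar> \<le> C / real k ^ Suc n)))"
    define centre where "centre g = (SOME f. near g f)" for g
    define G' where "G' = (\<lambda>(g, h) x. centre g x + h x) ` (G \<times> H)"
    have "finite G'" using G H by (simp add: G'_def)
    moreover have "real (card G') \<le> ?K ^ k"
    proof -
      have "card G' \<le> card G * card H"
        unfolding G'_def using card_image_le[of "G \<times> H"] G(1) H(1) by (simp add: card_cartesian_product)
      then have "real (card G') \<le> real (card G) * real (card H)" by (metis of_nat_le_iff of_nat_mult)
      also have "\<dots> \<le> K ^ k * (?A * 2 ^ (n + 2) * 64 ^ (4 + 1)) ^ k"
        using G(2) cH K by (intro mult_mono) auto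
      finally show ?thesis by (simp only: power_mult_distrib)
    qed
    moreover have "\<exists>g\<in>G'. \<forall>x\<in>{0..1}. \<bar>f x - g x\<bar> \<le> 4 * C / real k ^ Suc (Suc n)"
      if f: "f \<in> sobolev_ball (Suc n) R" for f
    proof -
      obtain f' where f': "f' \<in> sobolev_ball n R"
        "\<And>t. t \<in> {0..1} \<Longrightarrow> (f has_real_derivative f' t) (at t within {0..1})"
        using f by auto
      obtain g where g: "g \<in> G" "\<And>x. x \<in> {0..1} \<Longrightarrow> \<bar>f' x - g x\<bar> \<le> C / real k ^ Suc n"
        using G(3)[OF f'(1)] by blast
      have "near g f" unfolding near_def using f f'(2) g(2) by blast
      then have "near g (centre g)" unfolding centre_def by (rule someI[of "near g"])
      then obtain c' where c: "centre g \<in> sobolev_ball (Suc n) R"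
        "\<And>t. t \<in> {0..1} \<Longrightarrow> (centre g has_real_derivative c' t) (at t within {0..1})"
        "\<And>x. x \<in> {0..1} \<Longrightarrow> \<bar>c' x - g x\<bar> \<le> C / real k ^ Suc n"
        unfolding near_def by blast
      have "(\<lambda>x. f x - centre g x) \<in> bounded_energy (2 * R) V"
      proof (rule lipschitz_bounded_energy)
        fix t :: real assume t: "t \<in> {0..1}"
        show "((\<lambda>x. f x - centre g x) has_real_derivative f' t - c' t) (at t within {0..1})"
          using f'(2)[OF t] c(2)[OF t] by (rule DERIV_diff)
        have "V = C / real k ^ Suc n + C / real k ^ Suc n" by (simp add: V_def)
        then show "\<bar>f' t - c' t\<bar> \<le> V" using g(2)[OF t] c(3)[OF t] by linarith
      next
        have "\<bar>f 0\<bar> \<le> R" "\<bar>centre g 0\<bar> \<le> R" using f c(1) by auto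
        then show "\<bar>f 0 - centre g 0\<bar> \<le> 2 * R" by linarith
      qed
      from H(3)[OF this] obtain h where h: "h \<in> H"
        "\<And>x. x \<in> {0..1} \<Longrightarrow> \<bar>f x - centre g x - h x\<bar> \<le> 2 * \<eta>" by blast
      have "2 * \<eta> = 4 * C / real k ^ Suc (Suc n)" by (simp add: \<eta>_def V_def)
      then have "\<forall>x\<in>{0..1}. \<bar>f x - (centre g x + h x)\<bar> \<le> 4 * C / real k ^ Suc (Suc n)"
        using h(2) by (simp add: diff_diff_eq)
      moreover have "(\<lambda>x. centre g x + h x) \<in> G'"
        unfolding G'_def using g(1) h(1) by force
      ultimately show ?thesis by (rule bexI)
    qed
    ultimately show "\<exists>G. finite G \<and> real (card G) \<le> ?K ^ k \<and>
        (\<forall>f\<in>sobolev_ball (Suc n) (real r). \<exists>g\<in>G. \<forall>x\<in>{0..1}. \<bar>f x - g x\<bar> \<le> 4 * C / real k ^ Suc (Suc n))"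
      unfolding R_def by blast
  qed
qed

subsection \<open>Symmetrization of Gaussian processes\<close>

text \<open>Equality at $t = 0$ shows that the total masses agree. Dividing by the mass reduces to
  probability measures; mass zero is treated separately. Finite measures occur because restricting
  to events destroys normalization.\<close>

lemma Levy_uniqueness_finite:
  fixes M1 M2 :: "real measure"
  assumes fin: "finite_measure M1" "finite_measure M2"
    and sets: "sets M1 = sets borel" "sets M2 = sets borel"
    and eq: "\<And>t. (CLINT x|M1. iexp (t * x)) = (CLINT x|M2. iexp (t * x))"
  shows "M1 = M2"
proof -
  interpret M1: finite_measure M1 by fact
  interpret M2: finite_measure M2 by fact
  have sp: "space M1 = UNIV" "space M2 = UNIV"
    using sets sets_eq_imp_space_eq[of _ borel] by auto
  define m where "m = measure M1 UNIV"
  have m2: "measure M2 UNIV = m"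
    using eq[of 0] by (simp add: sp m_def complex_eq_iff scaleR_conv_of_real)
  show ?thesis
  proof (cases "m = 0")
    case True
    show ?thesis
    proof (rule measure_eqI)
      fix A assume A: "A \<in> sets M1"
      have "emeasure M1 A \<le> emeasure M1 UNIV" "emeasure M2 A \<le> emeasure M2 UNIV"
        using A sets sp by (auto intro!: emeasure_mono)
      then show "emeasure M1 A = emeasure M2 A"
        using True m2 M1.emeasure_eq_measure[of UNIV] M2.emeasure_eq_measure[of UNIV]
        by (simp add: m_def)
    qed (simp add: sets)
  next
    case False
    then have m: "m > 0" by (simp add: m_def zero_less_measure_iff)
    let ?N = "\<lambda>M. density M (\<lambda>_. ennreal (1 / m))"
    have em: "emeasure M1 UNIV = ennreal m" "emeasure M2 UNIV = ennreal m"
      using m2 by (simp_all add: m_def M1.emeasure_eq_measure M2.emeasure_eq_measure)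
    have N: "real_distribution (?N M)"
      if "finite_measure M" "sets M = sets borel" "emeasure M UNIV = ennreal m" for M :: "real measure"
    proof -
      have "space M = UNIV" using that sets_eq_imp_space_eq[of M borel] by simp
      then have "prob_space (?N M)"
        using that m by (intro prob_spaceI) (simp add: emeasure_density_const flip: ennreal_mult')
      then show ?thesis
        using that by (simp add: real_distribution_def real_distribution_axioms_def)
    qed
    have ch: "char (?N M) t = (1 / m) *\<^sub>R (CLINT x|M. iexp (t * x))"
      if "sets M = sets borel" for M :: "real measure" and t
      unfolding char_def
      by (subst integral_density) (use that m in \<open>auto simp: measurable_cong_sets[OF that refl]\<close>)
    have "?N M1 = ?N M2"
      by (rule Levy_uniqueness) (use N fin sets em ch eq in auto)
    then have *: "ennreal (1 / m) * emeasure M1 A = ennreal (1 / m) * emeasure M2 A" if "A \<in> sets borel" for A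
      using that sets emeasure_density_const[of A M1] emeasure_density_const[of A M2] by metis
    show ?thesis
    proof (rule measure_eqI)
      fix A assume "A \<in> sets M1"
      then have "ennreal m * (ennreal (1 / m) * emeasure M1 A) = ennreal m * (ennreal (1 / m) * emeasure M2 A)"
        using * sets by simp
      moreover have "ennreal m * ennreal (1 / m) = 1" using m by (simp flip: ennreal_mult')
      ultimately show "emeasure M1 A = emeasure M2 A" by (simp flip: mult.assoc)
    qed (simp add: sets)
  qed
qed

text \<open>The hypothesis equates the Fourier transforms of the images under \<open>P\<close> and
  \<open>Q\<close> of the measures with densities \<open>w\<close> and \<open>v\<close>. The common
  bound on the weights keeps these measures finite.\<close>

lemma weighted_law_eq:
  fixes P w :: "'a \<Rightarrow> real" and Q v :: "'b \<Rightarrow> real"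
  assumes "finite_measure M" "finite_measure N"
    and [measurable]: "P \<in> borel_measurable M" "w \<in> borel_measurable M"
    and [measurable]: "Q \<in> borel_measurable N" "v \<in> borel_measurable N"
    and w: "\<And>x. 0 \<le> w x" "\<And>x. w x \<le> b" and v: "\<And>x. 0 \<le> v x" "\<And>x. v x \<le> b"
    and eq: "\<And>s. (CLINT x|M. w x *\<^sub>R iexp (s * P x)) = (CLINT x|N. v x *\<^sub>R iexp (s * Q x))"
    and A[measurable]: "A \<in> sets borel"
  shows "(LINT x|M. w x * indicator A (P x)) = (LINT x|N. v x * indicator A (Q x))"
proof -
  interpret M: finite_measure M by fact
  interpret N: finite_measure N by fact
  let ?D = "\<lambda>M w P. distr (density M (\<lambda>x. ennreal (w x))) borel P"
  have D: "finite_measure (?D M w P) \<and> (\<forall>s. (CLINT x|?D M w P. iexp (s * x)) = (CLINT x|M. w x *\<^sub>R iexp (s * P x)))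
     \<and> measure (?D M w P) A = (LINT x|M. w x * indicator A (P x))"
    if "finite_measure M" and [measurable]: "P \<in> borel_measurable M" "w \<in> borel_measurable M"
      and w: "\<And>x. 0 \<le> w x" "\<And>x. w x \<le> b" for M :: "'c measure" and P w :: "'c \<Rightarrow> real"
  proof (intro conjI allI)
    interpret M: finite_measure M by fact
    have "(\<integral>\<^sup>+x. ennreal (w x) \<partial>M) \<le> (\<integral>\<^sup>+x. ennreal b \<partial>M)"
      using w by (intro nn_integral_mono) (auto intro: ennreal_leI)
    also have "\<dots> < \<infinity>" by (simp add: ennreal_mult_eq_top_iff M.emeasure_finite less_top[symmetric])
    finally have fin: "finite_measure (density M (\<lambda>x. ennreal (w x)))"
      by (intro finite_measureI) (simp add: emeasure_density nn_integral_set_ennreal cong: nn_integral_cong)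
    then interpret Dn: finite_measure "density M (\<lambda>x. ennreal (w x))" .
    show "finite_measure (?D M w P)" by (rule Dn.finite_measure_distr) simp
    show "(CLINT x|?D M w P. iexp (s * x)) = (CLINT x|M. w x *\<^sub>R iexp (s * P x))" for s
      by (subst integral_distr) (simp_all add: integral_density w)
    have "measure (?D M w P) A = (LINT x|?D M w P. indicator A x)" by simp
    also have "\<dots> = (LINT x|M. w x * indicator A (P x))"
      by (subst integral_distr) (simp_all add: integral_density w)
    finally show "measure (?D M w P) A = (LINT x|M. w x * indicator A (P x))" .
  qed
  have "?D M w P = ?D N v Q"
    by (rule Levy_uniqueness_finite) (use D[of M P w] D[of N Q v] assms in auto)
  then show ?thesis using D[of M P w] D[of N Q v] assms by metis
qed

lemma (in finite_measure) integrable_bounded: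
  fixes f :: "'a \<Rightarrow> 'b::{banach, second_countable_topology}"
  assumes "f \<in> borel_measurable M" "\<And>x. norm (f x) \<le> B"
  shows "integrable M f"
  by (rule integrable_const_bound[of _ B]) (use assms in auto)

text \<open>Levy's theorem needs a positive measure, so $e^{iu}$ is reached through the nonnegative
  weights $1 + \cos(u + \theta)$.\<close>

lemma restricted_iexp_integral_eq:
  fixes P u :: "'a \<Rightarrow> real" and Q v :: "'b \<Rightarrow> real"
  assumes "finite_measure M" "finite_measure N"
    and [measurable]: "P \<in> borel_measurable M" "u \<in> borel_measurable M"
    and [measurable]: "Q \<in> borel_measurable N" "v \<in> borel_measurable N"
    and eq: "\<And>s t. (CLINT x|M. iexp (s * P x + t * u x)) = (CLINT x|N. iexp (s * Q x + t * v x))"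
    and A[measurable]: "A \<in> sets borel"
  shows "(CLINT x|M. indicator A (P x) *\<^sub>R iexp (u x)) = (CLINT x|N. indicator A (Q x) *\<^sub>R iexp (v x))"
proof -
  interpret M: finite_measure M by fact
  interpret N: finite_measure N by fact
  \<comment> \<open>Writing the cosine as half the sum of two exponentials leaves joint
    characteristic functions at $t = 0, 1, -1$ only, and these agree by hypothesis.\<close>
  have expand: "(CLINT x|M. (1 + cos (u x + \<theta>)) *\<^sub>R iexp (s * P x)) =
      (CLINT x|M. iexp (s * P x + 0 * u x)) + iexp \<theta> / 2 * (CLINT x|M. iexp (s * P x + 1 * u x))
      + iexp (-\<theta>) / 2 * (CLINT x|M. iexp (s * P x + (-1) * u x))"
    if "finite_measure M" and [measurable]: "P \<in> borel_measurable M" "u \<in> borel_measurable M"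
    for M :: "'c measure" and P u and s \<theta> :: real
  proof -
    interpret M: finite_measure M by fact
    have int: "integrable M (\<lambda>x. iexp (s * P x + t * u x))" for t
      by (rule M.integrable_bounded[of _ 1]) auto
    have "(1 + cos (u x + \<theta>)) *\<^sub>R iexp (s * P x) = iexp (s * P x + 0 * u x)
      + iexp \<theta> / 2 * iexp (s * P x + 1 * u x) + iexp (-\<theta>) / 2 * iexp (s * P x + (-1) * u x)" for x
    proof -
      have "complex_of_real (cos (u x + \<theta>)) = (iexp (u x + \<theta>) + iexp (- (u x + \<theta>))) / 2"
        by (simp add: cos_exp_eq algebra_simps flip: cos_of_real)
      then show ?thesis
        by (simp add: scaleR_conv_of_real exp_add[symmetric] algebra_simps add_divide_distrib)
    qed
    moreover have "(CLINT x|M. f x + a * g x + b * h x) = (CLINT x|M. f x) + a * (CLINT x|M. g x) + b * (CLINT x|M. h x)"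
      if "integrable M f" "integrable M g" "integrable M h" for a b and f g h :: "'c \<Rightarrow> complex"
      using that by simp
    ultimately show ?thesis using int by presburger
  qed
  have cos_eq: "(LINT x|M. cos (u x + \<theta>) * indicator A (P x)) = (LINT x|N. cos (v x + \<theta>) * indicator A (Q x))" for \<theta>
  proof -
    have 1: "(LINT x|M. (1 + cos (u x + \<theta>)) * indicator A (P x)) = (LINT x|N. (1 + cos (v x + \<theta>)) * indicator A (Q x))"
    proof (rule weighted_law_eq[where b = 2])
      show "(CLINT x|M. (1 + cos (u x + \<theta>)) *\<^sub>R iexp (s * P x)) = (CLINT x|N. (1 + cos (v x + \<theta>)) *\<^sub>R iexp (s * Q x))" for s
        unfolding expand[OF assms(1,3,4)] expand[OF assms(2,5,6)] eq ..
      have c: "-1 \<le> cos y" "cos y \<le> 1" for y :: real by simp_all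
      show "0 \<le> 1 + cos (u x + \<theta>)" "1 + cos (u x + \<theta>) \<le> 2" for x using c[of "u x + \<theta>"] by linarith+
      show "0 \<le> 1 + cos (v x + \<theta>)" "1 + cos (v x + \<theta>) \<le> 2" for x using c[of "v x + \<theta>"] by linarith+
    qed (use assms in auto)
    have 2: "(LINT x|M. 1 * indicator A (P x)) = (LINT x|N. 1 * indicator A (Q x) :: real)"
      by (rule weighted_law_eq[where b = 1]) (use assms eq[of _ 0] in auto)
    have "integrable M (\<lambda>x. cos (u x + \<theta>) * indicator A (P x))"
      "integrable N (\<lambda>x. cos (v x + \<theta>) * indicator A (Q x))"
      "integrable M (\<lambda>x. indicator A (P x) :: real)" "integrable N (\<lambda>x. indicator A (Q x) :: real)"
      by (auto intro!: M.integrable_bounded[of _ 1] N.integrable_bounded[of _ 1] simp: indicator_def)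
    then show ?thesis using 1 2 by (simp add: distrib_right)
  qed
  have split: "(CLINT x|M. indicator A (P x) *\<^sub>R iexp (u x)) =
      Complex (LINT x|M. cos (u x + 0) * indicator A (P x)) (LINT x|M. cos (u x + (- pi / 2)) * indicator A (P x))"
    if "finite_measure M" and [measurable]: "P \<in> borel_measurable M" "u \<in> borel_measurable M"
    for M :: "'c measure" and P u
  proof -
    interpret M: finite_measure M by fact
    have "integrable M (\<lambda>x. indicator A (P x) *\<^sub>R iexp (u x))"
      by (rule M.integrable_bounded[of _ 1]) (auto simp: indicator_def)
    then have "Re (CLINT x|M. indicator A (P x) *\<^sub>R iexp (u x)) = (LINT x|M. Re (indicator A (P x) *\<^sub>R iexp (u x)))"
      "Im (CLINT x|M. indicator A (P x) *\<^sub>R iexp (u x)) = (LINT x|M. Im (indicator A (P x) *\<^sub>R iexp (u x)))"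
      by (simp_all only: integral_Re integral_Im)
    then show ?thesis
      by (simp add: complex_eq_iff Re_exp Im_exp cos_diff mult.commute cis_conv_exp[symmetric])
  qed
  show ?thesis
    unfolding split[OF assms(1,3,4)] split[OF assms(2,5,6)] cos_eq ..
qed

text \<open>Cramer--Wold, one coordinate at a time: restricting both measures to the event that one
  coordinate lies in its set preserves the hypothesis for the remaining coordinates.\<close>

lemma measure_boxes_eqI:
  fixes Y :: "'i \<Rightarrow> 'a \<Rightarrow> real" and Z :: "'i \<Rightarrow> 'b \<Rightarrow> real"
  assumes "finite I" "finite_measure M" "finite_measure N"
    and "\<And>i. i \<in> I \<Longrightarrow> Y i \<in> borel_measurable M"
    and "\<And>i. i \<in> I \<Longrightarrow> Z i \<in> borel_measurable N"
    and "\<And>c. (CLINT x|M. iexp (\<Sum>i\<in>I. c i * Y i x)) = (CLINT x|N. iexp (\<Sum>i\<in>I. c i * Z i x))"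
    and A: "\<And>i. A i \<in> sets borel"
  shows "measure M {x\<in>space M. \<forall>i\<in>I. Y i x \<in> A i} = measure N {x\<in>space N. \<forall>i\<in>I. Z i x \<in> A i}"
  using assms(1-6)
proof (induction I arbitrary: M N rule: finite_induct)
  case empty
  then show ?case by (simp add: complex_eq_iff scaleR_conv_of_real)
next
  case (insert i I)
  note [measurable] = A
  have mY[measurable]: "Y j \<in> borel_measurable M" if "j \<in> insert i I" for j using insert.prems that by auto
  have mZ[measurable]: "Z j \<in> borel_measurable N" if "j \<in> insert i I" for j using insert.prems that by auto
  let ?M = "density M (\<lambda>x. ennreal (indicator (A i) (Y i x)))"
  let ?N = "density N (\<lambda>x. ennreal (indicator (A i) (Z i x)))"
  have fin: "finite_measure (density M (\<lambda>x. ennreal (indicator (A i) (f x))))"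
    if "finite_measure M" and [measurable]: "f \<in> borel_measurable M" for M :: "'c measure" and f
  proof -
    interpret M: finite_measure M by fact
    have "(\<integral>\<^sup>+x. ennreal (indicator (A i) (f x)) \<partial>M) \<le> (\<integral>\<^sup>+x. 1 \<partial>M)"
      by (intro nn_integral_mono) (auto simp: indicator_def)
    also have "\<dots> < \<infinity>" by (simp add: M.emeasure_finite less_top[symmetric])
    finally show ?thesis
      by (intro finite_measureI) (simp add: emeasure_density cong: nn_integral_cong)
  qed
  have dens: "measure (density M (\<lambda>x. ennreal (indicator (A i) (f i x)))) {x\<in>space M. \<forall>j\<in>I. f j x \<in> A j}
      = measure M {x\<in>space M. \<forall>j\<in>insert i I. f j x \<in> A j}"
    if [measurable]: "\<And>j. j \<in> insert i I \<Longrightarrow> f j \<in> borel_measurable M" for M :: "'c measure" and f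
  proof -
    have S[measurable]: "{x\<in>space M. \<forall>j\<in>I. f j x \<in> A j} \<in> sets M"
      using insert.hyps(1) that by (intro sets.sets_Collect_finite_All) auto
    have "emeasure (density M (\<lambda>x. ennreal (indicator (A i) (f i x)))) {x\<in>space M. \<forall>j\<in>I. f j x \<in> A j}
      = (\<integral>\<^sup>+x. ennreal (indicator (A i) (f i x)) * indicator {x\<in>space M. \<forall>j\<in>I. f j x \<in> A j} x \<partial>M)"
      using that[of i] S by (intro emeasure_density) auto
    also have "\<dots> = (\<integral>\<^sup>+x. indicator {x\<in>space M. \<forall>j\<in>insert i I. f j x \<in> A j} x \<partial>M)"
      by (rule nn_integral_cong) (auto simp: indicator_def)
    also have "\<dots> = emeasure M {x\<in>space M. \<forall>j\<in>insert i I. f j x \<in> A j}"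
      using insert.hyps(1) that
      by (intro nn_integral_indicator sets.sets_Collect_finite_All) auto
    finally show ?thesis by (simp add: measure_def)
  qed
  have "measure ?M {x\<in>space ?M. \<forall>j\<in>I. Y j x \<in> A j} = measure ?N {x\<in>space ?N. \<forall>j\<in>I. Z j x \<in> A j}"
  proof (rule insert.IH)
    show "finite_measure ?M" "finite_measure ?N"
      using fin[OF insert.prems(1) mY[of i]] fin[OF insert.prems(2) mZ[of i]] by blast+
    show "Y j \<in> borel_measurable ?M" "Z j \<in> borel_measurable ?N" if "j \<in> I" for j
      using that mY mZ by auto
    fix c :: "'i \<Rightarrow> real"
    have "(CLINT x|M. indicator (A i) (Y i x) *\<^sub>R iexp (\<Sum>j\<in>I. c j * Y j x)) =
      (CLINT x|N. indicator (A i) (Z i x) *\<^sub>R iexp (\<Sum>j\<in>I. c j * Z j x))"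
    proof (rule restricted_iexp_integral_eq)
      fix s t :: real
      \<comment> \<open>The frequency \<open>s\<close> tests the coordinate being restricted, while
        \<open>t\<close> scales the combination of the others.\<close>
      let ?c = "\<lambda>j. if j = i then s else t * c j"
      have "(\<Sum>j\<in>insert i I. ?c j * f j) = s * f i + t * (\<Sum>j\<in>I. c j * f j)" for f :: "'i \<Rightarrow> real"
      proof -
        have "(\<Sum>j\<in>insert i I. ?c j * f j) = ?c i * f i + (\<Sum>j\<in>I. ?c j * f j)"
          using insert.hyps by (rule sum.insert)
        also have "(\<Sum>j\<in>I. ?c j * f j) = (\<Sum>j\<in>I. t * (c j * f j))"
          by (rule sum.cong) (use insert.hyps in auto)
        finally show ?thesis by (simp add: sum_distrib_left)
      qed
      then show "(CLINT x|M. iexp (s * Y i x + t * (\<Sum>j\<in>I. c j * Y j x)))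
        = (CLINT x|N. iexp (s * Z i x + t * (\<Sum>j\<in>I. c j * Z j x)))"
        using insert.prems(5)[of ?c] by simp
    qed (use insert.prems A in auto)
    then show "(CLINT x|?M. iexp (\<Sum>j\<in>I. c j * Y j x)) = (CLINT x|?N. iexp (\<Sum>j\<in>I. c j * Z j x))"
      using mY mZ by (subst (1 2) integral_density) auto
  qed
  then show ?case using dens[of Y M] dens[of Z N] mY mZ by simp
qed

section \<open>Characteristic functions of centered Gaussian variables\<close>

lemma gaussian_rv_integrable:
  assumes "gaussian_rv M Y"
  shows "integrable M Y"
proof -
  obtain \<mu> \<sigma> where Y[measurable]: "Y \<in> borel_measurable M" and "\<sigma> \<ge> 0"
    and d: "distr M borel Y = (if \<sigma> = 0 then return borel \<mu> else density lborel (normal_density \<mu> \<sigma>))"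
    using assms by (auto simp: gaussian_rv_def)
  have "integrable (distr M borel Y) (\<lambda>x. x)"
  proof (cases "\<sigma> = 0")
    case True
    then show ?thesis unfolding d by (simp add: integrable_iff_bounded nn_integral_return)
  next
    case False
    then have "\<sigma> > 0" using \<open>\<sigma> \<ge> 0\<close> by simp
    then show ?thesis
      unfolding d using integrable_normal_moment_nz_1[of \<sigma> \<mu>] by (simp add: integrable_density)
  qed
  then show ?thesis by (simp add: integrable_distr_eq)
qed

lemma integral_iexp_normal_density:
  assumes "\<sigma> > 0"
  shows "(CLINT x|lborel. normal_density 0 \<sigma> x *\<^sub>R iexp (t * x)) = of_real (exp (- (\<sigma> * t)\<^sup>2 / 2))"
proof -
  have "(CLINT x|lborel. normal_density 0 \<sigma> x *\<^sub>R iexp (t * x))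
     = \<bar>\<sigma>\<bar> *\<^sub>R (CLINT x|lborel. normal_density 0 \<sigma> (0 + \<sigma> * x) *\<^sub>R iexp (t * (0 + \<sigma> * x)))"
    using assms by (intro lborel_integral_real_affine) simp
  also have "\<dots> = (CLINT x|lborel. std_normal_density x *\<^sub>R iexp ((\<sigma> * t) * x))"
    unfolding integral_scaleR_right[symmetric] using assms
    by (intro Bochner_Integration.integral_cong) (auto simp: normal_density_def power_mult_distrib real_sqrt_mult field_simps)
  also have "\<dots> = char std_normal_distribution (\<sigma> * t)"
    unfolding char_def by (subst integral_density) auto
  finally show ?thesis by (simp add: char_std_normal_distribution)
qed

lemma centered_gaussian_char:
  assumes "gaussian_rv M Y" "integral\<^sup>L M Y = 0"
  obtains \<sigma> where "\<And>t. (CLINT x|M. iexp (t * Y x)) = of_real (exp (- (\<sigma> * t)\<^sup>2 / 2))"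
proof -
  obtain \<mu> \<sigma> where Y[measurable]: "Y \<in> borel_measurable M" and "\<sigma> \<ge> 0"
    and d: "distr M borel Y = (if \<sigma> = 0 then return borel \<mu> else density lborel (normal_density \<mu> \<sigma>))"
    using assms(1) by (auto simp: gaussian_rv_def)
  have "(LINT x|distr M borel Y. x) = \<mu>"
  proof (cases "\<sigma> = 0")
    case True
    then show ?thesis unfolding d by (simp add: integral_return)
  next
    case False
    then have "\<sigma> > 0" using \<open>\<sigma> \<ge> 0\<close> by simp
    then show ?thesis
      unfolding d using normal_moment_nz_1[of \<sigma> \<mu>]
      by (simp add: integral_density has_bochner_integral_iff)
  qed
  then have \<mu>: "\<mu> = 0" using assms(2) by (simp add: integral_distr)
  have "(CLINT x|M. iexp (t * Y x)) = of_real (exp (- (\<sigma> * t)\<^sup>2 / 2))" for t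
  proof -
    have "(CLINT x|M. iexp (t * Y x)) = (CLINT x|distr M borel Y. iexp (t * x))"
      by (simp add: integral_distr)
    also have "\<dots> = of_real (exp (- (\<sigma> * t)\<^sup>2 / 2))"
    proof (cases "\<sigma> = 0")
      case True
      then show ?thesis unfolding d by (simp add: integral_return \<mu>)
    next
      case False
      then have "\<sigma> > 0" using \<open>\<sigma> \<ge> 0\<close> by simp
      then show ?thesis
        unfolding d using integral_iexp_normal_density[of \<sigma> t]
        by (simp add: integral_density \<mu>)
    qed
    finally show ?thesis .
  qed
  then show ?thesis by (rule that)
qed

lemma symmetrization_char:
  assumes "prob_space M" "gaussian_rv M U" "integral\<^sup>L M U = 0"
  shows "(CLINT x|M \<Otimes>\<^sub>M M. iexp (U (fst x) - U (snd x))) = (CLINT x|M. iexp (sqrt 2 * U x))"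
proof -
  interpret prob_space M by fact
  interpret P: pair_prob_space M M ..
  obtain \<sigma> where \<sigma>: "\<And>t. (CLINT x|M. iexp (t * U x)) = of_real (exp (- (\<sigma> * t)\<^sup>2 / 2))"
    using centered_gaussian_char[OF assms(2,3)] by blast
  have [measurable]: "U \<in> borel_measurable M" using assms(2) by (simp add: gaussian_rv_def)
  have i: "iexp (U x - U y) = iexp (1 * U x) * iexp ((-1) * U y)" for x y
    by (simp add: algebra_simps flip: exp_add)
  have "(CLINT x|M \<Otimes>\<^sub>M M. iexp (U (fst x) - U (snd x))) = (CLINT x|M. CLINT y|M. iexp (U x - U y))"
  proof -
    have "integrable (M \<Otimes>\<^sub>M M) (\<lambda>z. iexp (U (fst z) - U (snd z)))"
      by (rule P.integrable_const_bound[of _ 1]) auto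
    from P.integral_fst'[OF this] show ?thesis by simp
  qed
  also have "\<dots> = (CLINT x|M. iexp (1 * U x)) * (CLINT y|M. iexp ((-1) * U y))"
    unfolding i integral_mult_right_zero integral_mult_left_zero ..
  also have "\<dots> = of_real (exp (- (\<sigma> * sqrt 2)\<^sup>2 / 2))"
    unfolding \<sigma> of_real_mult[symmetric] exp_add[symmetric] by (simp add: power_mult_distrib)
  also have "\<dots> = (CLINT x|M. iexp (sqrt 2 * U x))" unfolding \<sigma> ..
  finally show ?thesis .
qed

lemma centered_gaussian_process_sum:
  assumes "centered_gaussian_process M I X" "finite T" "T \<subseteq> I"
  shows "gaussian_rv M (\<lambda>\<omega>. \<Sum>t\<in>T. c t * X t \<omega>)" "(LINT \<omega>|M. (\<Sum>t\<in>T. c t * X t \<omega>)) = 0"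
proof -
  have gp: "gaussian_process M I X" and zero: "\<And>t. t \<in> I \<Longrightarrow> integral\<^sup>L M (X t) = 0"
    using assms(1) by (auto simp: centered_gaussian_process_def)
  show "gaussian_rv M (\<lambda>\<omega>. \<Sum>t\<in>T. c t * X t \<omega>)"
    using gp assms(2,3) by (simp add: gaussian_process_def)
  have "gaussian_rv M (X t)" if "t \<in> I" for t
    using gp that unfolding gaussian_process_def by (elim allE[of _ "{t}"] allE[of _ "\<lambda>_. 1"]) auto
  then have "integrable M (X t)" if "t \<in> T" for t
    using that assms(3) gaussian_rv_integrable by blast
  then have "(LINT \<omega>|M. (\<Sum>t\<in>T. c t * X t \<omega>)) = (\<Sum>t\<in>T. c t * integral\<^sup>L M (X t))"
    by (subst Bochner_Integration.integral_sum) auto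
  also have "\<dots> = 0" using zero assms(3) by (intro sum.neutral) auto
  finally show "(LINT \<omega>|M. (\<Sum>t\<in>T. c t * X t \<omega>)) = 0" .
qed

lemma centered_gaussian_process_measurable:
  assumes "centered_gaussian_process M I X" "t \<in> I"
  shows "X t \<in> borel_measurable M"
  using centered_gaussian_process_sum(1)[OF assms(1), of "{t}" "\<lambda>_. 1"] assms(2)
  by (simp add: gaussian_rv_def)

text \<open>Every linear combination of the $X_t$ is again centered Gaussian, so the one-dimensional
  identity supplies all joint characteristic functions that the box comparison requires.\<close>

lemma symmetrization_box:
  assumes M: "prob_space M" and X: "centered_gaussian_process M I X" and T: "finite T" "T \<subseteq> I"
  shows "measure (M \<Otimes>\<^sub>M M) {x\<in>space (M \<Otimes>\<^sub>M M). \<forall>t\<in>T. \<bar>X t (fst x) - X t (snd x)\<bar> \<le> r}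
       = measure M {\<omega>\<in>space M. \<forall>t\<in>T. sqrt 2 * \<bar>X t \<omega>\<bar> \<le> r}"
proof -
  interpret prob_space M by fact
  interpret P: pair_prob_space M M ..
  have [measurable]: "X t \<in> borel_measurable M" if "t \<in> T" for t
    using centered_gaussian_process_measurable[OF X] that T by auto
  have "measure (M \<Otimes>\<^sub>M M) {x\<in>space (M \<Otimes>\<^sub>M M). \<forall>t\<in>T. X t (fst x) - X t (snd x) \<in> {-r..r}}
       = measure M {\<omega>\<in>space M. \<forall>t\<in>T. sqrt 2 * X t \<omega> \<in> {-r..r}}"
  proof (rule measure_boxes_eqI)
    fix c :: "'b \<Rightarrow> real"
    let ?U = "\<lambda>\<omega>. \<Sum>t\<in>T. c t * X t \<omega>"
    show "(CLINT x|M \<Otimes>\<^sub>M M. iexp (\<Sum>t\<in>T. c t * (X t (fst x) - X t (snd x))))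
        = (CLINT x|M. iexp (\<Sum>t\<in>T. c t * (sqrt 2 * X t x)))"
      using symmetrization_char[OF M centered_gaussian_process_sum[OF X T, of c]]
      by (simp add: right_diff_distrib sum_subtractf sum_distrib_left mult.left_commute)
  qed (use T in \<open>auto intro: P.finite_measure_axioms finite_measure_axioms\<close>)
  moreover have "\<bar>y\<bar> \<le> r \<longleftrightarrow> y \<in> {-r..r}" for y :: real
    by (auto simp: abs_le_iff)
  moreover have "sqrt 2 * \<bar>y\<bar> = \<bar>sqrt 2 * y\<bar>" for y
    by (simp add: abs_mult)
  ultimately show ?thesis by simp
qed

subsection \<open>Norms and regularity of paths\<close>

definition grid_point :: "nat \<Rightarrow> real \<Rightarrow> real" where
  "grid_point k t = real (nat \<lfloor>real (Suc k) * t\<rfloor>) / real (Suc k)"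

lemma grid_point_bounds:
  assumes "t \<in> {0..1}"
  shows "grid_point k t \<in> {0..1}" "grid_point k t \<in> \<rat>" "\<bar>grid_point k t - t\<bar> \<le> 1 / real (Suc k)"
proof -
  define y where "y = real (Suc k) * t"
  let ?f = "real_of_int \<lfloor>y\<rfloor>"
  have nn: "0 \<le> y" using assms by (simp add: y_def)
  have e: "grid_point k t = ?f / real (Suc k)"
    unfolding grid_point_def y_def[symmetric] using nn by simp
  have "y \<le> real (Suc k) * 1" unfolding y_def using assms by (intro mult_left_mono) auto
  then have yk: "y \<le> real (Suc k)" by simp
  have b: "0 \<le> ?f" "?f \<le> y" "y - 1 \<le> ?f" "?f \<le> real (Suc k)"
    using nn yk of_int_floor_le[of y] floor_correct[of y] by (simp, linarith+)
  show "grid_point k t \<in> {0..1}" unfolding e using b by simp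
  show "grid_point k t \<in> \<rat>" unfolding e by (intro Rats_divide) auto
  have "\<bar>?f - y\<bar> / real (Suc k) \<le> 1 / real (Suc k)"
    using b by (intro divide_right_mono) linarith+
  moreover have "grid_point k t - t = (?f - y) / real (Suc k)"
    unfolding e by (simp add: diff_divide_distrib y_def)
  ultimately show "\<bar>grid_point k t - t\<bar> \<le> 1 / real (Suc k)" by simp
qed

lemma grid_point_tendsto:
  assumes "continuous_on {0..1} f" "t \<in> {0..1}"
  shows "(\<lambda>k. f (grid_point k t)) \<longlonglongrightarrow> f t"
proof -
  have "(\<lambda>k. grid_point k t - t) \<longlonglongrightarrow> 0"
    by (rule Lim_null_comparison[OF _ LIMSEQ_inverse_real_of_nat])
      (use grid_point_bounds(3)[OF assms(2)] in \<open>simp add: inverse_eq_divide\<close>)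
  then have "(\<lambda>k. grid_point k t) \<longlonglongrightarrow> t" by (rule LIM_zero_cancel)
  then show ?thesis
    using assms grid_point_bounds(1)[OF assms(2)]
    by (auto intro: continuous_on_tendsto_compose[OF assms(1)])
qed

lemma bounded_on_rationals:
  fixes f :: "real \<Rightarrow> real"
  assumes "continuous_on {0..1} f" "\<forall>t\<in>\<rat> \<inter> {0..1}. \<bar>f t\<bar> \<le> B" "t \<in> {0..1}"
  shows "\<bar>f t\<bar> \<le> B"
proof (rule LIMSEQ_le_const2)
  show "(\<lambda>k. \<bar>f (grid_point k t)\<bar>) \<longlonglongrightarrow> \<bar>f t\<bar>"
    by (intro tendsto_rabs grid_point_tendsto assms)
  show "\<exists>N. \<forall>k\<ge>N. \<bar>f (grid_point k t)\<bar> \<le> B"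
    using assms(2) grid_point_bounds[OF assms(3)] by auto
qed

lemma continuous_on_measurable_lebesgue_on:
  "continuous_on {0..1::real} (f :: real \<Rightarrow> real) \<Longrightarrow> f \<in> borel_measurable (lebesgue_on {0..1})"
  by (rule continuous_imp_measurable_on_sets_lebesgue) auto

interpretation unit_interval: prob_space "lebesgue_on {0..1::real}"
  by (rule prob_spaceI) (simp add: emeasure_restrict_space)

lemma enn2real_exponent_ge_1:
  assumes "1 \<le> p" "p \<noteq> \<infinity>"
  shows "1 \<le> enn2real p"
  using assms by (cases p) (auto simp: ennreal_le_iff simp flip: ennreal_1)

lemma Lp_norm01_le:
  assumes f: "f \<in> borel_measurable (lebesgue_on {0..1})" and p: "1 \<le> p"
    and B: "\<And>t. t \<in> {0..1} \<Longrightarrow> \<bar>f t\<bar> \<le> B"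
  shows "Lp_norm01 p f \<le> ennreal B"
proof (cases "p = \<infinity>")
  case True
  have "esssup (lebesgue_on {0..1}) (\<lambda>t. ennreal \<bar>f t\<bar>) \<le> ennreal B"
    using f B by (intro esssup_I AE_I2) (auto intro: ennreal_leI)
  then show ?thesis using True f by (simp add: Lp_norm01_def)
next
  case False
  define q where "q = enn2real p"
  have q: "1 \<le> q" unfolding q_def by (rule enn2real_exponent_ge_1[OF p False])
  have B0: "0 \<le> B" using B[of 0] by simp
  define J where "J = (\<integral>\<^sup>+ t. ennreal (\<bar>f t\<bar> powr q) \<partial>lebesgue_on {0..1})"
  have "J \<le> (\<integral>\<^sup>+ t. ennreal (B powr q) \<partial>lebesgue_on {0..1::real})"
    unfolding J_def
  proof (rule nn_integral_mono)
    fix t :: real assume "t \<in> space (lebesgue_on {0..1})"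
    then have "\<bar>f t\<bar> \<le> B" using B by simp
    then show "ennreal (\<bar>f t\<bar> powr q) \<le> ennreal (B powr q)"
      using q by (intro ennreal_leI powr_mono2) auto
  qed
  also have "\<dots> = ennreal (B powr q)" using unit_interval.emeasure_space_1 by simp
  finally have J: "J \<le> ennreal (B powr q)" .
  then have "J \<noteq> \<infinity>" by (auto simp: top_unique)
  moreover have "enn2real J powr (1 / q) \<le> B"
  proof -
    have "enn2real J \<le> B powr q" using enn2real_mono[OF J] by simp
    then have "enn2real J powr (1 / q) \<le> (B powr q) powr (1 / q)"
      using q by (intro powr_mono2) auto
    also have "\<dots> = B" using q B0 by (simp add: powr_powr)
    finally show ?thesis .
  qed
  ultimately show ?thesis
    using False f unfolding Lp_norm01_def q_def[symmetric] J_def[symmetric] Let_def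
    by (auto intro: ennreal_leI)
qed

lemma esssup_le_iff_continuous:
  fixes f :: "real \<Rightarrow> real"
  assumes c: "continuous_on {0..1} f" and "0 \<le> B"
  shows "esssup (lebesgue_on {0..1}) (\<lambda>t. ennreal \<bar>f t\<bar>) \<le> ennreal B \<longleftrightarrow>
    (\<forall>t\<in>\<rat> \<inter> {0..1}. \<bar>f t\<bar> \<le> B)"
proof
  let ?C = "{t\<in>{0..1}. \<bar>f t\<bar> \<le> B}"
  assume "esssup (lebesgue_on {0..1}) (\<lambda>t. ennreal \<bar>f t\<bar>) \<le> ennreal B"
  then have "AE t in lebesgue_on {0..1}. ennreal \<bar>f t\<bar> \<le> ennreal B"
    using esssup_AE[where M = "lebesgue_on {0..1}" and f = "\<lambda>t. ennreal \<bar>f t\<bar>"] by (auto elim!: eventually_mono)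
  then have "AE t in lebesgue. t \<in> {0..1} \<longrightarrow> \<bar>f t\<bar> \<le> B"
    using \<open>0 \<le> B\<close> by (subst (asm) AE_restrict_space_iff) (auto simp: ennreal_le_iff)
  then have ae: "AE t \<in> {0<..<1} in lebesgue. t \<in> ?C" by (auto elim: eventually_mono)
  have cl: "closed ?C"
  proof -
    have "closed ({0..1} \<inter> (\<lambda>t. \<bar>f t\<bar>) -` {..B})"
      using c by (intro continuous_closed_preimage continuous_on_rabs) auto
    also have "{0..1} \<inter> (\<lambda>t. \<bar>f t\<bar>) -` {..B} = ?C" by auto
    finally show ?thesis .
  qed
  have "{0<..<1} \<subseteq> ?C"
    using mem_closed_if_AE_lebesgue_open[OF open_greaterThanLessThan cl ae] by blast
  then have "closure {0<..<1} \<subseteq> ?C" using cl by (rule closure_minimal)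
  then show "\<forall>t\<in>\<rat> \<inter> {0..1}. \<bar>f t\<bar> \<le> B" by auto
next
  assume "\<forall>t\<in>\<rat> \<inter> {0..1}. \<bar>f t\<bar> \<le> B"
  then have "\<bar>f t\<bar> \<le> B" if "t \<in> {0..1}" for t using bounded_on_rationals[OF c _ that] by blast
  then show "esssup (lebesgue_on {0..1}) (\<lambda>t. ennreal \<bar>f t\<bar>) \<le> ennreal B"
    using continuous_on_measurable_lebesgue_on[OF c] by (intro esssup_I AE_I2) (auto intro: ennreal_leI)
qed

lemma Lp_norm01_sublevel_measurable:
  fixes Y :: "real \<Rightarrow> 'a \<Rightarrow> real"
  assumes m: "\<And>t. t \<in> {0..1} \<Longrightarrow> Y t \<in> borel_measurable M"
    and c: "\<And>\<omega>. \<omega> \<in> space M \<Longrightarrow> continuous_on {0..1} (\<lambda>t. Y t \<omega>)"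
    and p: "1 \<le> p" and B: "0 \<le> B"
  shows "{\<omega>\<in>space M. Lp_norm01 p (\<lambda>t. Y t \<omega>) \<le> ennreal B} \<in> sets M"
proof (cases "p = \<infinity>")
  case True
  have "{\<omega>\<in>space M. Lp_norm01 p (\<lambda>t. Y t \<omega>) \<le> ennreal B}
      = {\<omega>\<in>space M. \<forall>t\<in>\<rat> \<inter> {0..1}. \<bar>Y t \<omega>\<bar> \<le> B}"
    using c continuous_on_measurable_lebesgue_on[OF c] esssup_le_iff_continuous[OF c B] True
    by (auto simp: Lp_norm01_def)
  also have "\<dots> \<in> sets M"
    by (intro sets.sets_Collect_countable_All') (use m in \<open>auto intro: countable_Int1 countable_rat\<close>)
  finally show ?thesis .
next
  case False
  define q where "q = enn2real p"
  let ?L = "lebesgue_on {0..1::real}"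
  \<comment> \<open>Joint measurability comes from the pointwise limit of the processes frozen at
    grid points, each of which switches between finitely many random variables.\<close>
  have "(\<lambda>x. Y (snd x) (fst x)) \<in> borel_measurable (M \<Otimes>\<^sub>M ?L)"
  proof (rule borel_measurable_LIMSEQ_real)
    show "(\<lambda>k. Y (grid_point k (snd x)) (fst x)) \<longlonglongrightarrow> Y (snd x) (fst x)"
      if "x \<in> space (M \<Otimes>\<^sub>M ?L)" for x
      using that by (intro grid_point_tendsto[of "\<lambda>t. Y t (fst x)"] c) (auto simp: space_pair_measure)
    fix k
    let ?g = "\<lambda>t. nat \<lfloor>real (Suc k) * t\<rfloor>"
    have g: "?g \<in> ?L \<rightarrow>\<^sub>M count_space {0..Suc k}"
    proof -
      have "(\<lambda>t. real (Suc k) * t) \<in> borel_measurable ?L"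
        by (intro continuous_on_measurable_lebesgue_on continuous_intros)
      then have "?g \<in> ?L \<rightarrow>\<^sub>M count_space UNIV" by measurable
      then have "?g -` {a} \<inter> space ?L \<in> sets ?L" for a by (rule measurable_sets) simp
      moreover have "?g t \<le> Suc k" if "t \<in> {0..1}" for t
        using grid_point_bounds(1)[OF that, of k] by (simp add: grid_point_def)
      ultimately show ?thesis by (subst measurable_count_space_eq2) auto
    qed
    show "(\<lambda>x. Y (grid_point k (snd x)) (fst x)) \<in> borel_measurable (M \<Otimes>\<^sub>M ?L)"
      unfolding grid_point_def
    proof (rule measurable_compose_countable'[where f = "\<lambda>i x. Y (real i / real (Suc k)) (fst x)" and I = "{0..Suc k}"])
      show "(\<lambda>x. Y (real i / real (Suc k)) (fst x)) \<in> borel_measurable (M \<Otimes>\<^sub>M ?L)" if "i \<in> {0..Suc k}" for i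
        using that m[of "real i / real (Suc k)"] by simp
      show "(\<lambda>x. nat \<lfloor>real (Suc k) * snd x\<rfloor>) \<in> M \<Otimes>\<^sub>M ?L \<rightarrow>\<^sub>M count_space {0..Suc k}"
        using measurable_compose[OF measurable_snd g] .
    qed simp
  qed
  then have [measurable]: "(\<lambda>(\<omega>, t). ennreal (\<bar>Y t \<omega>\<bar> powr q)) \<in> borel_measurable (M \<Otimes>\<^sub>M ?L)"
    by (simp add: split_beta)
  define J where "J \<omega> = (\<integral>\<^sup>+ t. ennreal (\<bar>Y t \<omega>\<bar> powr q) \<partial>?L)" for \<omega>
  have [measurable]: "J \<in> borel_measurable M"
    unfolding J_def by (intro unit_interval.borel_measurable_nn_integral) measurable
  have "{\<omega>\<in>space M. Lp_norm01 p (\<lambda>t. Y t \<omega>) \<le> ennreal B} =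
    {\<omega>\<in>space M. (if J \<omega> = \<infinity> then \<infinity> else ennreal (enn2real (J \<omega>) powr (1 / q))) \<le> ennreal B}"
    using continuous_on_measurable_lebesgue_on[OF c] False
    by (auto simp: Lp_norm01_def q_def[symmetric] J_def[symmetric] Let_def)
  also have "\<dots> \<in> sets M" by measurable
  finally show ?thesis .
qed

text \<open>Setting the paths to zero on a null set gives the everywhere continuous process
  \<open>Y\<close>, whose small ball event is measurable. The event for \<open>X\<close> differs
  from it only inside that null set, so it is measurable for the completion.\<close>

lemma small_ball_prob_ge:
  fixes X :: "real \<Rightarrow> 'a \<Rightarrow> real"
  assumes "prob_space M"
    and m: "\<And>t. t \<in> {0..1} \<Longrightarrow> X t \<in> borel_measurable M"
    and c: "AE \<omega> in M. continuous_on {0..1} (\<lambda>t. X t \<omega>)"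
    and p: "1 \<le> p" and \<epsilon>: "0 \<le> \<epsilon>"
  shows "measure M {\<omega>\<in>space M. \<forall>t\<in>\<rat> \<inter> {0..1}. \<bar>X t \<omega>\<bar> \<le> \<epsilon>} \<le> small_ball_prob M X p \<epsilon>"
proof -
  interpret prob_space M by fact
  interpret C: prob_space "completion M" by (rule prob_space_completion)
  obtain N where N: "{\<omega>\<in>space M. \<not> continuous_on {0..1} (\<lambda>t. X t \<omega>)} \<subseteq> N" "N \<in> null_sets M"
    using c by (auto elim: AE_E3 simp: eventually_ae_filter)
  then have [measurable]: "N \<in> sets M" by auto
  define Y where "Y t \<omega> = (if \<omega> \<in> N then 0 else X t \<omega>)" for t \<omega>
  let ?small = "\<lambda>X. {\<omega>\<in>space M. Lp_norm01 p (\<lambda>t. X t \<omega>) \<le> ennreal \<epsilon>}"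
  have Y: "?small Y \<in> sets M"
  proof (rule Lp_norm01_sublevel_measurable[OF _ _ p \<epsilon>])
    show "Y t \<in> borel_measurable M" if "t \<in> {0..1}" for t
      unfolding Y_def using m[OF that] by measurable
    show "continuous_on {0..1} (\<lambda>t. Y t \<omega>)" if "\<omega> \<in> space M" for \<omega>
      using N(1) that by (cases "\<omega> \<in> N") (auto simp: Y_def)
  qed
  have XY: "\<omega> \<in> ?small X \<longleftrightarrow> \<omega> \<in> ?small Y" if "\<omega> \<notin> N" for \<omega>
    using that by (simp add: Y_def)
  \<comment> \<open>Essential for the lower bound: \<open>measure\<close> would return 0 on a set
    outside the sigma-algebra.\<close>
  have small: "?small X \<in> sets (completion M)"
  proof (rule sets_completionI)
    show "?small X = (?small Y - N) \<union> (?small X \<inter> N)" using XY by blast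
    show "?small Y - N \<in> sets M" using Y by auto
  qed (use N in auto)
  let ?sup = "{\<omega>\<in>space M. \<forall>t\<in>\<rat> \<inter> {0..1}. \<bar>X t \<omega>\<bar> \<le> \<epsilon>}"
  have sup[measurable]: "?sup \<in> sets M"
    by (intro sets.sets_Collect_countable_All') (use m in \<open>auto intro: countable_Int1 countable_rat\<close>)
  have sub: "?sup - N \<subseteq> ?small X"
  proof
    fix \<omega> assume \<omega>: "\<omega> \<in> ?sup - N"
    then have c: "continuous_on {0..1} (\<lambda>t. X t \<omega>)" using N(1) by auto
    have "Lp_norm01 p (\<lambda>t. X t \<omega>) \<le> ennreal \<epsilon>"
      by (rule Lp_norm01_le[OF continuous_on_measurable_lebesgue_on[OF c] p])
         (use bounded_on_rationals[OF c, of \<epsilon>] \<omega> in auto)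
    then show "\<omega> \<in> ?small X" using \<omega> by auto
  qed
  have "measure M ?sup = measure M (?sup - N)"
    using N(2) by (simp add: measure_Diff_null_set)
  also have "\<dots> = measure (completion M) (?sup - N)" by (simp add: sets.Diff)
  also have "\<dots> \<le> measure (completion M) (?small X)"
    using sub small by (rule C.finite_measure_mono)
  finally show ?thesis by (simp add: small_ball_prob_def)
qed

section \<open>Regular paths lie in Sobolev balls\<close>

text \<open>\<open>nth_deriv01\<close> recurses at the last derivative, \<open>sobolev_ball\<close>
  at the first one; this reconciles the two orders.\<close>

lemma nth_deriv01_shift: "nth_deriv01 n (nth_deriv01 (Suc 0) f) = nth_deriv01 (Suc n) f"
  by (induction n) auto

lemma differentiable_nth_deriv01:
  assumes "nth_deriv01 k f differentiable_on {0..1}" "t \<in> {0..1}"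
  shows "(nth_deriv01 k f has_vector_derivative nth_deriv01 (Suc k) f t) (at t within {0..1})"
proof -
  have "nth_deriv01 k f differentiable (at t within {0..1})"
    using assms by (simp add: differentiable_on_def)
  then show ?thesis by (simp add: vector_derivative_works)
qed

lemma square_integral_bound:
  fixes f f' :: "real \<Rightarrow> real"
  assumes d: "\<And>t. t \<in> {0..1} \<Longrightarrow> (f has_vector_derivative f' t) (at t within {0..1})"
    and sq: "(\<lambda>t. (f' t)\<^sup>2) integrable_on {0..1}"
  shows "controlled_by (\<lambda>t. integral {0..t} (\<lambda>t. (f' t)\<^sup>2)) f 0 1"
  unfolding controlled_by_def
proof (intro allI impI)
  fix s t :: real assume st: "0 \<le> s \<and> s \<le> t \<and> t \<le> 1"
  let ?I = "\<lambda>a b. integral {a..b} (\<lambda>t. (f' t)\<^sup>2)"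
  have int: "(\<lambda>t. (f' t)\<^sup>2) integrable_on {a..b}" if "{a..b} \<subseteq> {0..1}" for a b
    using integrable_on_subinterval[OF sq that] .
  have E: "?I 0 t - ?I 0 s = ?I s t"
    using Henstock_Kurzweil_Integration.integral_combine[of 0 s t "\<lambda>t. (f' t)\<^sup>2"] st int[of 0 t] by auto
  show "(f t - f s)\<^sup>2 \<le> (t - s) * (?I 0 t - ?I 0 s)"
  proof (cases "s = t")
    case False
    then have h: "0 < t - s" using st by simp
    define c where "c = (f t - f s) / (t - s)"
    have "(f' has_integral (f t - f s)) {s..t}"
      using st by (intro fundamental_theorem_of_calculus) (auto intro: has_vector_derivative_within_subset[OF d])
    moreover have "((\<lambda>t. (f' t)\<^sup>2) has_integral ?I s t) {s..t}"
      using int[of s t] st by (auto intro: integrable_integral)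
    ultimately have "((\<lambda>x. (f' x)\<^sup>2 - 2 * c * f' x + c\<^sup>2) has_integral
        (?I s t - 2 * c * (f t - f s) + c\<^sup>2 * (t - s))) {s..t}"
      using st has_integral_const_real[of "c\<^sup>2" s t]
      by (intro has_integral_add has_integral_diff has_integral_mult_right) (auto simp: mult.commute)
    then have "0 \<le> ?I s t - 2 * c * (f t - f s) + c\<^sup>2 * (t - s)"
    proof (rule has_integral_nonneg)
      show "0 \<le> (f' x)\<^sup>2 - 2 * c * f' x + c\<^sup>2" for x
        using zero_le_power2[of "f' x - c"] by (simp add: power2_diff algebra_simps)
    qed
    also have "c\<^sup>2 * (t - s) = c * (f t - f s)"
      using h by (simp add: c_def power2_eq_square)
    also have "?I s t - 2 * c * (f t - f s) + c * (f t - f s) = ?I s t - (f t - f s)\<^sup>2 / (t - s)"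
      by (simp add: c_def power2_eq_square)
    finally show ?thesis unfolding E using h by (simp add: field_simps)
  qed simp
qed

lemma in_Lp01_2_square_integrable:
  assumes "in_Lp01 2 f"
  shows "(\<lambda>t. (f t)\<^sup>2) integrable_on {0..1}"
proof -
  have f[measurable]: "f \<in> borel_measurable (lebesgue_on {0..1})"
    using assms by (auto simp: in_Lp01_def Lp_norm01_def split: if_splits)
  have "(\<integral>\<^sup>+ t. ennreal (\<bar>f t\<bar> powr 2) \<partial>lebesgue_on {0..1}) \<noteq> \<infinity>"
    using assms f by (auto simp: in_Lp01_def Lp_norm01_def Let_def split: if_splits)
  then have "integrable (lebesgue_on {0..1}) (\<lambda>t. (f t)\<^sup>2)"
    by (intro integrableI_bounded) (auto simp: powr_numeral less_top)
  then show ?thesis by (rule integrable_on_lebesgue_on) auto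
qed

lemma bounded_energy_mono:
  assumes "B \<le> B'" "0 \<le> V" "V \<le> V'"
  shows "bounded_energy B V \<subseteq> bounded_energy B' V'"
proof
  fix f assume "f \<in> bounded_energy B V"
  then obtain E where "\<bar>f 0\<bar> \<le> B" "controlled_by E f 0 1" "E 1 - E 0 \<le> V\<^sup>2"
    by (auto simp: bounded_energy_def)
  moreover have "V\<^sup>2 \<le> V'\<^sup>2" using assms by (intro power_mono) auto
  ultimately show "f \<in> bounded_energy B' V'"
    using assms(1) unfolding bounded_energy_def by (intro CollectI conjI exI[of _ E]) linarith+
qed

lemma sobolev_ball_mono:
  assumes "0 \<le> R" "R \<le> R'"
  shows "sobolev_ball n R \<subseteq> sobolev_ball n R'"
proof (induction n)
  case 0
  then show ?case using bounded_energy_mono assms by simp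
next
  case (Suc n)
  then show ?case using assms by fastforce
qed

lemma in_sobolev_ball:
  assumes "times_differentiable01 (Suc n) f" "in_Lp01 2 (nth_deriv01 (Suc n) f)"
  shows "\<exists>r::nat. f \<in> sobolev_ball n (real r)"
  using assms
proof (induction n arbitrary: f)
  case 0
  have d: "(f has_vector_derivative nth_deriv01 (Suc 0) f t) (at t within {0..1})" if "t \<in> {0..1}" for t
    using differentiable_nth_deriv01[of 0 f t] 0(1) that by (simp add: times_differentiable01_def)
  let ?E = "\<lambda>t. integral {0..t} (\<lambda>t. (nth_deriv01 (Suc 0) f t)\<^sup>2)"
  have c: "controlled_by ?E f 0 1"
    using d in_Lp01_2_square_integrable[OF 0(2)] by (rule square_integral_bound)
  obtain r :: nat where r: "\<bar>f 0\<bar> + \<bar>?E 1 - ?E 0\<bar> + 1 \<le> real r" using real_arch_simple by blast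
  have "real r \<le> (real r)\<^sup>2" using r by (intro self_le_power) linarith+
  then have "f \<in> bounded_energy (real r) (real r)"
    unfolding bounded_energy_def using c r by (intro CollectI conjI exI[of _ ?E]) linarith+
  then show ?case by auto
next
  case (Suc n)
  let ?f' = "nth_deriv01 (Suc 0) f"
  have d: "(f has_vector_derivative ?f' t) (at t within {0..1})" if "t \<in> {0..1}" for t
  proof -
    have "nth_deriv01 0 f differentiable_on {0..1}"
      using Suc.prems(1) unfolding times_differentiable01_def by blast
    from differentiable_nth_deriv01[OF this that] show ?thesis by simp
  qed
  have "times_differentiable01 (Suc n) ?f'"
    using Suc.prems(1) unfolding times_differentiable01_def nth_deriv01_shift by auto
  moreover have "in_Lp01 2 (nth_deriv01 (Suc n) ?f')"
    using Suc.prems(2) unfolding nth_deriv01_shift .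
  ultimately obtain r where r: "?f' \<in> sobolev_ball n (real r)" using Suc.IH by blast
  obtain r' :: nat where r': "\<bar>f 0\<bar> + real r \<le> real r'" using real_arch_simple by blast
  have "?f' \<in> sobolev_ball n (real r')"
  proof -
    have "0 \<le> real r" "real r \<le> real r'" using r' by linarith+
    from sobolev_ball_mono[OF this] r show ?thesis by blast
  qed
  moreover have "\<bar>f 0\<bar> \<le> real r'" using r' by linarith
  ultimately have "f \<in> sobolev_ball (Suc n) (real r')"
    using d unfolding sobolev_ball.simps has_real_derivative_iff_has_vector_derivative by blast
  then show ?case by blast
qed

lemma smooth01_in_Lp01:
  assumes "smooth01 f"
  shows "in_Lp01 2 (nth_deriv01 n f)"
proof -
  have "nth_deriv01 n f differentiable_on {0..1}"
    using assms by (auto simp: smooth01_def times_differentiable01_def)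
  then have c: "continuous_on {0..1} (nth_deriv01 n f)" by (rule differentiable_imp_continuous_on)
  then have "bounded (nth_deriv01 n f ` {0..1})" by (intro compact_imp_bounded compact_continuous_image) auto
  then obtain B where "\<forall>x\<in>nth_deriv01 n f ` {0..1}. norm x \<le> B" unfolding bounded_iff by blast
  then have "\<bar>nth_deriv01 n f t\<bar> \<le> B" if "t \<in> {0..1}" for t using that by simp
  then have "Lp_norm01 2 (nth_deriv01 n f) \<le> ennreal B"
    using continuous_on_measurable_lebesgue_on[OF c] by (intro Lp_norm01_le) auto
  then show ?thesis by (auto simp: in_Lp01_def intro: le_less_trans)
qed

subsection \<open>Small ball probabilities\<close>

text \<open>The triangle inequality eliminates the centre \<open>g\<close>, about which nothing is
  assumed. Laws can be compared on finite sets of times only, so \<open>S\<close> is exhausted by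
  the finite sets \<open>T j\<close>, and continuity of the measure from above gives the
  limit.\<close>

lemma shifted_ball_bound:
  fixes X :: "'i \<Rightarrow> 'a \<Rightarrow> real"
  assumes M: "prob_space M" and X: "centered_gaussian_process M I X"
    and S: "countable S" "S \<subseteq> I"
  shows "(measure M {\<omega>\<in>space M. \<forall>t\<in>S. \<bar>X t \<omega> - g t\<bar> \<le> \<eta>})\<^sup>2
       \<le> measure M {\<omega>\<in>space M. \<forall>t\<in>S. \<bar>X t \<omega>\<bar> \<le> sqrt 2 * \<eta>}"
proof (cases "S = {}")
  case True
  then show ?thesis using M by (simp add: prob_space.prob_space)
next
  case False
  interpret prob_space M by fact
  interpret P: pair_prob_space M M ..
  have m[measurable]: "X t \<in> borel_measurable M" if "t \<in> S" for t
    using centered_gaussian_process_measurable[OF X] that S by auto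
  let ?U = "{\<omega>\<in>space M. \<forall>t\<in>S. \<bar>X t \<omega> - g t\<bar> \<le> \<eta>}"
  have U: "?U \<in> sets M"
    by (intro sets.sets_Collect_countable_All') (use m S in auto)
  define T where "T j = from_nat_into S ` {..j}" for j :: nat
  have T: "finite (T j)" "T j \<subseteq> S" for j
    using from_nat_into[OF False] by (auto simp: T_def)
  have UT: "(\<Union>j. T j) = S"
  proof -
    have "(\<Union>j. T j) = from_nat_into S ` (\<Union>j. {..j})" unfolding T_def by blast
    also have "(\<Union>j. {..j}) = (UNIV :: nat set)" by auto
    finally show ?thesis using range_from_nat_into[OF False S(1)] by simp
  qed
  have Tmono: "j \<le> k \<Longrightarrow> T j \<subseteq> T k" for j k by (auto simp: T_def)
  let ?B = "\<lambda>j. {\<omega>\<in>space M. \<forall>t\<in>T j. \<bar>X t \<omega>\<bar> \<le> sqrt 2 * \<eta>}"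
  have B: "?B j \<in> sets M" for j
    by (intro sets.sets_Collect_finite_All) (use m T[of j] in auto)
  have le: "(measure M ?U)\<^sup>2 \<le> measure M (?B j)" for j
  proof -
    let ?D = "{x\<in>space (M \<Otimes>\<^sub>M M). \<forall>t\<in>T j. \<bar>X t (fst x) - X t (snd x)\<bar> \<le> 2 * \<eta>}"
    have D: "?D \<in> sets (M \<Otimes>\<^sub>M M)"
    proof (intro sets.sets_Collect_finite_All)
      fix t assume "t \<in> T j"
      then have [measurable]: "X t \<in> borel_measurable M" using m T[of j] by auto
      show "{x\<in>space (M \<Otimes>\<^sub>M M). \<bar>X t (fst x) - X t (snd x)\<bar> \<le> 2 * \<eta>} \<in> sets (M \<Otimes>\<^sub>M M)"
        by measurable
    qed (use T in auto)
    have sub: "?U \<times> ?U \<subseteq> ?D"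
    proof
      fix x assume x: "x \<in> ?U \<times> ?U"
      have "\<bar>X t (fst x) - X t (snd x)\<bar> \<le> 2 * \<eta>" if "t \<in> T j" for t
      proof -
        have "t \<in> S" using that T[of j] by auto
        then have "\<bar>X t (fst x) - g t\<bar> \<le> \<eta>" "\<bar>X t (snd x) - g t\<bar> \<le> \<eta>" using x by auto
        then show ?thesis by linarith
      qed
      then show "x \<in> ?D" using x by (auto simp: space_pair_measure)
    qed
    have "emeasure (M \<Otimes>\<^sub>M M) (?U \<times> ?U) = emeasure M ?U * emeasure M ?U"
      by (rule emeasure_pair_measure_Times[OF U U])
    then have "measure (M \<Otimes>\<^sub>M M) (?U \<times> ?U) = measure M ?U * measure M ?U"
      by (simp add: measure_def enn2real_mult)
    then have "(measure M ?U)\<^sup>2 = measure (M \<Otimes>\<^sub>M M) (?U \<times> ?U)" by (simp add: power2_eq_square)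
    also have "\<dots> \<le> measure (M \<Otimes>\<^sub>M M) ?D" using sub D by (rule P.finite_measure_mono)
    also have "\<dots> = measure M {\<omega>\<in>space M. \<forall>t\<in>T j. sqrt 2 * \<bar>X t \<omega>\<bar> \<le> 2 * \<eta>}"
      using T[of j] S by (intro symmetrization_box[OF M X]) auto
    also have "{\<omega>\<in>space M. \<forall>t\<in>T j. sqrt 2 * \<bar>X t \<omega>\<bar> \<le> 2 * \<eta>} = ?B j"
    proof -
      have "2 * \<eta> = sqrt 2 * (sqrt 2 * \<eta>)" by simp
      then have "sqrt 2 * y \<le> 2 * \<eta> \<longleftrightarrow> y \<le> sqrt 2 * \<eta>" for y
        by (metis mult_le_cancel_left_pos real_sqrt_gt_zero zero_less_numeral)
      then show ?thesis by simp
    qed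
    finally show ?thesis .
  qed
  have "(\<lambda>j. measure M (?B j)) \<longlonglongrightarrow> measure M (\<Inter>j. ?B j)"
  proof (rule finite_Lim_measure_decseq)
    show "decseq ?B" unfolding decseq_def using Tmono by blast
  qed (use B in auto)
  also have "(\<Inter>j. ?B j) = {\<omega>\<in>space M. \<forall>t\<in>S. \<bar>X t \<omega>\<bar> \<le> sqrt 2 * \<eta>}"
    using UT by auto
  finally show ?thesis by (rule LIMSEQ_le_const) (use le in auto)
qed

lemma sobolev_class_small_ball:
  fixes X :: "real \<Rightarrow> 'a \<Rightarrow> real"
  assumes M: "prob_space M" and X: "centered_gaussian_process M {0..1} X"
    and paths: "AE \<omega> in M. \<exists>r::nat. (\<lambda>t. X t \<omega>) \<in> sobolev_ball n (real r)"
  shows "\<exists>c>0. \<exists>K\<ge>1. \<exists>C>0. \<forall>k\<ge>1.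
    (c / K ^ k)\<^sup>2 \<le> measure M {\<omega>\<in>space M. \<forall>t\<in>\<rat> \<inter> {0..1}. \<bar>X t \<omega>\<bar> \<le> C / real k ^ Suc n}"
proof -
  interpret prob_space M by fact
  let ?S = "\<rat> \<inter> {0..1::real}"
  have S: "countable ?S" "?S \<subseteq> {0..1}" by (auto intro: countable_Int1 countable_rat)
  define covers where "covers r k b G \<longleftrightarrow> finite G \<and> real (card G) \<le> fst b ^ k \<and>
     (\<forall>f\<in>sobolev_ball n (real r). \<exists>g\<in>G. \<forall>x\<in>{0..1}. \<bar>f x - g x\<bar> \<le> snd b / real k ^ Suc n)"
    for r k :: nat and b :: "real \<times> real" and G
  have "\<exists>b. 1 \<le> fst b \<and> 0 < snd b \<and> (\<forall>k\<ge>1. \<exists>G. covers r k b G)" for r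
    using sobolev_ball_entropy[of n r] unfolding covers_def by auto
  \<comment> \<open>The pair \<open>b r\<close> holds the base and the radius constant for radius
    \<open>r\<close>; it is chosen before \<open>k\<close>.\<close>
  then obtain b where b: "\<And>r. 1 \<le> fst (b r) \<and> 0 < snd (b r) \<and> (\<forall>k\<ge>1. \<exists>G. covers r k (b r) G)"
    by metis
  define K where "K r = fst (b r)" for r
  define C where "C r = snd (b r)" for r
  have K: "1 \<le> K r" and C: "0 < C r" for r
    using b by (auto simp: K_def C_def)
  define G where "G r k = (SOME G. covers r k (b r) G)" for r k
  have "covers r k (b r) (G r k)" if "1 \<le> k" for r k
    unfolding G_def by (rule someI_ex) (use b that in blast)
  then have G: "\<And>r k. 1 \<le> k \<Longrightarrow> finite (G r k)"
    "\<And>r k. 1 \<le> k \<Longrightarrow> real (card (G r k)) \<le> K r ^ k"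
    "\<And>r k f. 1 \<le> k \<Longrightarrow> f \<in> sobolev_ball n (real r) \<Longrightarrow>
       \<exists>g\<in>G r k. \<forall>x\<in>{0..1}. \<bar>f x - g x\<bar> \<le> C r / real k ^ Suc n"
    unfolding covers_def K_def C_def by blast+
  define U where "U r k g = {\<omega>\<in>space M. \<forall>t\<in>?S. \<bar>X t \<omega> - g t\<bar> \<le> C r / real k ^ Suc n}" for r k g
  have U: "U r k g \<in> sets M" for r k g
    unfolding U_def
    by (intro sets.sets_Collect_countable_All') (use centered_gaussian_process_measurable[OF X] S in auto)
  define V where "V r k = (\<Union>g\<in>G r k. U r k g)" for r k
  have V: "V r k \<in> sets M" if "1 \<le> k" for r k
    unfolding V_def using G(1)[OF that] U by auto
  \<comment> \<open>The event that the path lies in a Sobolev ball need not be measurable; \<open>W r\<close> contains it.\<close>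
  define W where "W r = (\<Inter>k\<in>{1..}. V r k)" for r
  have W: "W r \<in> sets M" for r
    unfolding W_def using V by (intro sets.countable_INT') auto
  \<comment> \<open>Intersecting over all \<open>k\<close> before measuring yields one probability
    for all scales. Almost every path lies in some \<open>W r\<close>, so these countably many
    events cannot all be null.\<close>
  have "\<exists>r. measure M (W r) > 0"
  proof (rule ccontr)
    assume "\<not> ?thesis"
    then have "measure M (W r) = 0" for r by (simp add: zero_less_measure_iff)
    then have "W r \<in> null_sets M" for r using W by (simp add: null_sets_def emeasure_eq_measure)
    then have "AE \<omega> in M. \<omega> \<notin> W r" for r by (rule AE_not_in)
    then have "AE \<omega> in M. \<forall>r. \<omega> \<notin> W r" by (simp add: AE_all_countable)
    with paths AE_space have "AE \<omega> in M. False"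
    proof eventually_elim
      case (elim \<omega>)
      then obtain r :: nat where r: "(\<lambda>t. X t \<omega>) \<in> sobolev_ball n (real r)" by blast
      have "\<omega> \<in> V r k" if k: "1 \<le> k" for k
      proof -
        obtain g where "g \<in> G r k" "\<forall>x\<in>{0..1}. \<bar>X x \<omega> - g x\<bar> \<le> C r / real k ^ Suc n"
          using G(3)[OF k r] by blast
        then show ?thesis using elim S unfolding V_def U_def by blast
      qed
      then have "\<omega> \<in> W r" by (auto simp: W_def)
      then show False using elim by blast
    qed
    then show False by simp
  qed
  then obtain r where r: "measure M (W r) > 0" by blast
  define c where "c = measure M (W r)"
  have "(c / K r ^ k)\<^sup>2 \<le> measure M {\<omega>\<in>space M. \<forall>t\<in>?S. \<bar>X t \<omega>\<bar> \<le> sqrt 2 * C r / real k ^ Suc n}"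
    if k: "1 \<le> k" for k
  proof -
    have Kk: "0 < K r ^ k" using K[of r] by (intro zero_less_power) linarith
    \<comment> \<open>Pigeonhole: at most $K^k$ events cover \<open>W r\<close>, so one of them has
      at least the average share of \<open>c\<close>.\<close>
    have "\<exists>g\<in>G r k. c / K r ^ k \<le> measure M (U r k g)"
    proof (rule ccontr)
      assume "\<not> ?thesis"
      then have small: "measure M (U r k g) < c / K r ^ k" if "g \<in> G r k" for g
        using that by (auto simp: not_le)
      have "c \<le> measure M (V r k)"
        unfolding c_def using k V[OF k] by (intro finite_measure_mono) (auto simp: W_def)
      also have "\<dots> \<le> (\<Sum>g\<in>G r k. measure M (U r k g))"
        unfolding V_def using G(1)[OF k] U by (intro finite_measure_subadditive_finite) auto
      finally have c_le: "c \<le> (\<Sum>g\<in>G r k. measure M (U r k g))" .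
      then have "G r k \<noteq> {}" using r by (auto simp: c_def)
      then have "(\<Sum>g\<in>G r k. measure M (U r k g)) < real (card (G r k)) * (c / K r ^ k)"
        using small G(1)[OF k] by (intro sum_bounded_above_strict) (auto simp: card_gt_0_iff)
      also have "\<dots> \<le> K r ^ k * (c / K r ^ k)"
        using G(2)[OF k] r Kk by (intro mult_right_mono) (auto simp: c_def)
      also have "\<dots> = c" using less_imp_neq[OF Kk] by simp
      finally show False using c_le by simp
    qed
    then obtain g where g: "c / K r ^ k \<le> measure M (U r k g)" by blast
    have "(c / K r ^ k)\<^sup>2 \<le> (measure M (U r k g))\<^sup>2"
      using g r Kk by (intro power_mono) (auto simp: c_def)
    also have "\<dots> \<le> measure M {\<omega>\<in>space M. \<forall>t\<in>?S. \<bar>X t \<omega>\<bar> \<le> sqrt 2 * (C r / real k ^ Suc n)}"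
      unfolding U_def by (rule shifted_ball_bound[OF M X S])
    finally show ?thesis by simp
  qed
  then show ?thesis
    using r K[of r] C[of r] unfolding c_def
    by (intro exI[of _ "measure M (W r)"] conjI exI[of _ "K r"] exI[of _ "sqrt 2 * C r"]) auto
qed

lemma small_ball_exponent:
  fixes X :: "real \<Rightarrow> 'a \<Rightarrow> real"
  assumes M: "prob_space M" and X: "centered_gaussian_process M {0..1} X"
    and p: "1 \<le> p"
    and paths: "AE \<omega> in M. times_differentiable01 (Suc n) (\<lambda>t. X t \<omega>) \<and>
              in_Lp01 2 (nth_deriv01 (Suc n) (\<lambda>t. X t \<omega>))"
  shows "\<exists>B. \<forall>\<epsilon>. 0 < \<epsilon> \<and> \<epsilon> \<le> 1 \<longrightarrow>
    ereal (\<epsilon> powr (1 / real (Suc n))) * neg_log (small_ball_prob M X p \<epsilon>) \<le> ereal B"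
proof -
  interpret prob_space M by fact
  have "AE \<omega> in M. \<exists>r::nat. (\<lambda>t. X t \<omega>) \<in> sobolev_ball n (real r)"
    using paths by eventually_elim (use in_sobolev_ball in blast)
  from sobolev_class_small_ball[OF M X this] obtain c K C where c: "0 < c" and K: "1 \<le> K" and C: "0 < C"
    and lower: "\<And>k. 1 \<le> k \<Longrightarrow> (c / K ^ k)\<^sup>2 \<le>
      measure M {\<omega>\<in>space M. \<forall>t\<in>\<rat> \<inter> {0..1}. \<bar>X t \<omega>\<bar> \<le> C / real k ^ Suc n}"
    by blast
  have cont: "AE \<omega> in M. continuous_on {0..1} (\<lambda>t. X t \<omega>)"
    using paths
  proof eventually_elim
    case (elim \<omega>)
    then have "nth_deriv01 0 (\<lambda>t. X t \<omega>) differentiable_on {0..1}"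
      unfolding times_differentiable01_def by blast
    then show ?case using differentiable_imp_continuous_on by auto
  qed
  define a where "a = 1 / real (Suc n)"
  define B where "B = 2 * ((C powr a + 1) * ln K + \<bar>ln c\<bar>)"
  have "ereal (\<epsilon> powr a) * neg_log (small_ball_prob M X p \<epsilon>) \<le> ereal B" if \<epsilon>: "0 < \<epsilon>" "\<epsilon> \<le> 1" for \<epsilon>
  proof -
    define y where "y = (C / \<epsilon>) powr a"
    define k where "k = nat \<lceil>y\<rceil>"
    have y: "0 < y" using C \<epsilon> by (simp add: y_def)
    then have k: "1 \<le> k" "y \<le> real k" "real k \<le> y + 1" unfolding k_def by linarith+
    have "C / \<epsilon> = y powr real (Suc n)"
      using C \<epsilon> by (simp add: y_def a_def powr_powr del: of_nat_Suc)
    also have "\<dots> = y ^ Suc n" using y by (rule powr_realpow)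
    also have "\<dots> \<le> real k ^ Suc n" using k y by (intro power_mono) auto
    finally have Ck: "C / real k ^ Suc n \<le> \<epsilon>"
      using k \<epsilon> by (simp add: field_simps)
    have "(c / K ^ k)\<^sup>2 \<le> measure M {\<omega>\<in>space M. \<forall>t\<in>\<rat> \<inter> {0..1}. \<bar>X t \<omega>\<bar> \<le> C / real k ^ Suc n}"
      using lower k by blast
    also have "\<dots> \<le> measure M {\<omega>\<in>space M. \<forall>t\<in>\<rat> \<inter> {0..1}. \<bar>X t \<omega>\<bar> \<le> \<epsilon>}"
    proof (rule finite_measure_mono)
      show "{\<omega>\<in>space M. \<forall>t\<in>\<rat> \<inter> {0..1}. \<bar>X t \<omega>\<bar> \<le> \<epsilon>} \<in> sets M"
        by (intro sets.sets_Collect_countable_All')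
          (use centered_gaussian_process_measurable[OF X] in \<open>auto intro: countable_Int1 countable_rat\<close>)
    qed (use Ck in force)
    also have "\<dots> \<le> small_ball_prob M X p \<epsilon>"
      using centered_gaussian_process_measurable[OF X] cont p \<epsilon>
      by (intro small_ball_prob_ge[OF M]) auto
    finally have sb: "(c / K ^ k)\<^sup>2 \<le> small_ball_prob M X p \<epsilon>" .
    have pos: "0 < (c / K ^ k)\<^sup>2" using c K by simp
    have "- ln (small_ball_prob M X p \<epsilon>) \<le> - ln ((c / K ^ k)\<^sup>2)"
      using ln_mono[OF sb pos] by simp
    also have "\<dots> = 2 * (real k * ln K - ln c)"
      using c K by (simp add: ln_realpow ln_div)
    also have "\<dots> \<le> 2 * ((y + 1) * ln K + \<bar>ln c\<bar>)"
    proof -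
      have "real k * ln K \<le> (y + 1) * ln K" using k K by (intro mult_right_mono) auto
      moreover have "- ln c \<le> \<bar>ln c\<bar>" by simp
      ultimately have "real k * ln K - ln c \<le> (y + 1) * ln K + \<bar>ln c\<bar>"
        by (metis add_mono diff_conv_add_uminus)
      then show ?thesis by simp
    qed
    finally have ln_bound: "- ln (small_ball_prob M X p \<epsilon>) \<le> 2 * ((y + 1) * ln K + \<bar>ln c\<bar>)" .
    have e1: "\<epsilon> powr a \<le> 1" "0 \<le> \<epsilon> powr a" using \<epsilon> by (auto simp: a_def powr_le1)
    have ey: "\<epsilon> powr a * y = C powr a" using \<epsilon> C by (simp add: y_def powr_divide)
    have "\<epsilon> powr a * (- ln (small_ball_prob M X p \<epsilon>)) \<le> \<epsilon> powr a * (2 * ((y + 1) * ln K + \<bar>ln c\<bar>))"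
      using ln_bound e1 by (intro mult_left_mono)
    also have "\<dots> = 2 * ((\<epsilon> powr a * y + \<epsilon> powr a) * ln K + \<epsilon> powr a * \<bar>ln c\<bar>)"
      by (simp add: algebra_simps)
    also have "\<dots> \<le> B"
    proof -
      have "(\<epsilon> powr a * y + \<epsilon> powr a) * ln K \<le> (C powr a + 1) * ln K"
        using e1 K unfolding ey by (intro mult_right_mono) auto
      moreover have "\<epsilon> powr a * \<bar>ln c\<bar> \<le> 1 * \<bar>ln c\<bar>" using e1 by (intro mult_right_mono) auto
      ultimately show ?thesis unfolding B_def mult_1 by (intro mult_left_mono add_mono) auto
    qed
    finally show ?thesis using less_le_trans[OF pos sb] by (simp add: neg_log_def)
  qed
  then show ?thesis unfolding a_def by blast
qed

lemma neg_log_nonneg: "x \<le> 1 \<Longrightarrow> 0 \<le> neg_log x"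
  by (simp add: neg_log_def)

theorem corollary9:
  fixes M :: "'a measure" and X :: "real \<Rightarrow> 'a \<Rightarrow> real" and p :: ennreal and n :: nat
  assumes "prob_space M"
    and "centered_gaussian_process M {0..1} X"
    and "AE \<omega> in M. X 0 \<omega> = 0"
    and "1 \<le> p"
    and "n \<ge> 1"
  shows "((AE \<omega> in M. times_differentiable01 n (\<lambda>t. X t \<omega>) \<and>
              in_Lp01 2 (nth_deriv01 n (\<lambda>t. X t \<omega>)))
           \<longrightarrow> Limsup (at_right 0)
                 (\<lambda>\<epsilon>::real. ereal (\<epsilon> powr (1 / real n)) * neg_log (small_ball_prob M X p \<epsilon>)) < \<infinity>)
       \<and> ((AE \<omega> in M. smooth01 (\<lambda>t. X t \<omega>))
           \<longrightarrow> (\<forall>\<delta>::real. \<delta> > 0 \<longrightarrow>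
                 ((\<lambda>\<epsilon>::real. ereal (\<epsilon> powr \<delta>) * neg_log (small_ball_prob M X p \<epsilon>)) \<longlongrightarrow> 0)
                   (at_right 0)))"
proof (intro conjI impI allI)
  have near0: "eventually (\<lambda>\<epsilon>::real. 0 < \<epsilon> \<and> \<epsilon> \<le> 1) (at_right 0)"
    by (auto simp: eventually_at_right_field intro!: exI[of _ 1])
  {
    assume paths: "AE \<omega> in M. times_differentiable01 n (\<lambda>t. X t \<omega>) \<and>
              in_Lp01 2 (nth_deriv01 n (\<lambda>t. X t \<omega>))"
    obtain m where n: "n = Suc m" using \<open>n \<ge> 1\<close> by (cases n) auto
    obtain B where B: "\<And>\<epsilon>. 0 < \<epsilon> \<and> \<epsilon> \<le> 1 \<Longrightarrow>
        ereal (\<epsilon> powr (1 / real n)) * neg_log (small_ball_prob M X p \<epsilon>) \<le> ereal B"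
      using small_ball_exponent[OF assms(1,2,4) paths[unfolded n]] unfolding n by blast
    have "Limsup (at_right 0)
        (\<lambda>\<epsilon>::real. ereal (\<epsilon> powr (1 / real n)) * neg_log (small_ball_prob M X p \<epsilon>)) \<le> ereal B"
      by (rule Limsup_bounded) (use near0 B in \<open>auto elim!: eventually_mono\<close>)
    also have "\<dots> < \<infinity>" by simp
    finally show "Limsup (at_right 0)
        (\<lambda>\<epsilon>::real. ereal (\<epsilon> powr (1 / real n)) * neg_log (small_ball_prob M X p \<epsilon>)) < \<infinity>" .
  next
    fix \<delta> :: real
    assume smooth: "AE \<omega> in M. smooth01 (\<lambda>t. X t \<omega>)" and \<delta>: "0 < \<delta>"
    obtain m where m: "1 / real (Suc m) < \<delta>" using nat_approx_posE[OF \<delta>] by blast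
    define a where "a = 1 / real (Suc m)"
    have "AE \<omega> in M. times_differentiable01 (Suc m) (\<lambda>t. X t \<omega>) \<and>
              in_Lp01 2 (nth_deriv01 (Suc m) (\<lambda>t. X t \<omega>))"
      using smooth
    proof eventually_elim
      case (elim \<omega>)
      then show ?case using smooth01_in_Lp01[OF elim, of "Suc m"] unfolding smooth01_def by blast
    qed
    from small_ball_exponent[OF assms(1,2,4) this] obtain B where B: "\<And>\<epsilon>. 0 < \<epsilon> \<and> \<epsilon> \<le> 1 \<Longrightarrow>
        ereal (\<epsilon> powr a) * neg_log (small_ball_prob M X p \<epsilon>) \<le> ereal B"
      unfolding a_def by blast
    have prob: "small_ball_prob M X p \<epsilon> \<le> 1" for \<epsilon>
      unfolding small_ball_prob_def
      by (intro prob_space.prob_le_1 prob_space.prob_space_completion assms(1))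
    show "((\<lambda>\<epsilon>::real. ereal (\<epsilon> powr \<delta>) * neg_log (small_ball_prob M X p \<epsilon>)) \<longlongrightarrow> 0) (at_right 0)"
    proof (rule tendsto_sandwich)
      show "eventually (\<lambda>\<epsilon>. 0 \<le> ereal (\<epsilon> powr \<delta>) * neg_log (small_ball_prob M X p \<epsilon>)) (at_right 0)"
        using neg_log_nonneg[OF prob] by simp
      show "eventually (\<lambda>\<epsilon>. ereal (\<epsilon> powr \<delta>) * neg_log (small_ball_prob M X p \<epsilon>)
          \<le> ereal (\<epsilon> powr (\<delta> - a) * B)) (at_right 0)"
        using near0
      proof eventually_elim
        case (elim \<epsilon>)
        have "ereal (\<epsilon> powr \<delta>) * neg_log (small_ball_prob M X p \<epsilon>)
            = ereal (\<epsilon> powr (\<delta> - a)) * (ereal (\<epsilon> powr a) * neg_log (small_ball_prob M X p \<epsilon>))"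
          by (simp add: powr_add[symmetric] flip: mult.assoc)
        also have "\<dots> \<le> ereal (\<epsilon> powr (\<delta> - a)) * ereal B"
          using B[OF elim] by (intro ereal_mult_left_mono) auto
        finally show ?case by simp
      qed
      have "((\<lambda>\<epsilon>::real. \<epsilon> powr (\<delta> - a)) \<longlongrightarrow> 0) (at_right 0)"
      proof (rule tendsto_zero_powrI)
        show "\<forall>\<^sub>F x in at_right 0. 0 \<le> (x :: real)"
          using near0 by eventually_elim simp
      qed (use m in \<open>auto simp: a_def intro: tendsto_ident_at\<close>)
      then have "((\<lambda>\<epsilon>::real. \<epsilon> powr (\<delta> - a) * B) \<longlongrightarrow> 0) (at_right 0)"
        by (rule tendsto_mult_left_zero)
      then show "((\<lambda>\<epsilon>::real. ereal (\<epsilon> powr (\<delta> - a) * B)) \<longlongrightarrow> 0) (at_right 0)"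
        by (simp add: zero_ereal_def)
    qed simp
  }
qed

end
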